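(* Let $A,B$ be unital $C^*$-algebras, $H$ a finite dimensional $C^*$-Hopf algebra with dual $C^*$-Hopf algebra $H^0$, $\rho$ and $\sigma$ coactions of $H^0$ on $A$ and $B$, $X$ an $A-B$-equivalence bimodule, and $\lambda$ a coaction of $H^0$ on $X$ with respect to $(A,B,\rho,\sigma)$. Let $C=A\rtimes_\rho H$, $D=B\rtimes_\sigma H$, $Y=X\rtimes_\lambda H$, let $\tau$ be the Haar trace on $H$, and define linear maps $E_1^\rho:C\to A$, $E_1^\sigma:D\to B$, $E_1^\lambda:Y\to X$ by $$E_1^\rho(a\rtimes_\rho h)=\tau(h)a,\quad E_1^\sigma(b\rtimes_\sigma h)=\tau(h)b,\quad E_1^\lambda(x\rtimes_\lambda h)=\tau(h)x$$ for $a\in A$, $b\in B$, $x\in X$, $h\in H$. Then $E_1^\lambda$ is a conditional expectation from $X\rtimes_\lambda H$ onto $X$ with respect to $E_1^\rho$ and $E_1^\sigma$.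
   Context: Equivalence bimodules are imprimitivity bimodules (full for both inner products); left and right actions are written $a\cdot x$, $x\cdot b$; ${}_A\langle x,y\rangle$ is the left inner product (linear in the first variable) and $\langle x,y\rangle_B$ the right inner product (linear in the second variable). Coactions. Let $\Delta^0,\epsilon^0$ be the comultiplication and counit of $H^0$. A coaction of $H^0$ on $A$ is a unital $*$-homomorphism $\rho:A\to A\otimes H^0$ with $(\rho\otimes\mathrm{id})\rho=(\mathrm{id}\otimes\Delta^0)\rho$ and $(\mathrm{id}\otimes\epsilon^0)\rho=\mathrm{id}$. A coaction of $H^0$ on $X$ with respect to $(A,B,\rho,\sigma)$ is a linear map $\lambda:X\to X\otimes H^0$ with $\lambda(a\cdot x)=\rho(a)\cdot\lambda(x)$, $\lambda(x\cdot b)=\lambda(x)\cdot\sigma(b)$, $\rho({}_A\langle x,y\rangle)={}_{A\otimes H^0}\langle\lambda(x),\lambda(y)\rangle$, $\sigma(\langle x,y\rangle_B)=\langle\lambda(x),\lambda(y)\rangle_{B\otimes H^0}$, $(\mathrm{id}\otimes\epsilon^0)\lambda=\mathrm{id}$ and $(\lambda\otimes\mathrm{id})\lambda=(\mathrm{id}\otimes\Delta^0)\lambda$. The induced action of $H$ is $h\cdot_\rho a=(\mathrm{id}\otimes h)(\rho(a))$ (elements of $H$ viewed as functionals on $H^0$), and similarly for $\sigma$, $\lambda$. Crossed products (Sweedler notation $\Delta(h)=h_{(1)}\otimes h_{(2)}$, antipode $S$). $C=A\rtimes_\rho H$ is $A\otimes H$ as a vector space, with elementary tensors written $a\rtimes_\rho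 h$, product $(a\rtimes_\rho h)(b\rtimes_\rho l)=a[h_{(1)}\cdot_\rho b]\rtimes_\rho h_{(2)}l$ and involution $(a\rtimes_\rho h)^*=[h_{(1)}^*\cdot_\rho a^*]\rtimes_\rho h_{(2)}^*$; similarly $D$. $Y=X\rtimes_\lambda H$ is $X\otimes H$ as a vector space, with elementary tensors $x\rtimes_\lambda h$ and $(a\rtimes_\rho h)\cdot(x\rtimes_\lambda l)=a\cdot[h_{(1)}\cdot_\lambda x]\rtimes_\lambda h_{(2)}l$, $(x\rtimes_\lambda h)\cdot(b\rtimes_\sigma l)=x\cdot[h_{(1)}\cdot_\sigma b]\rtimes_\lambda h_{(2)}l$, ${}_C\langle x\rtimes_\lambda h,y\rtimes_\lambda l\rangle={}_A\langle x,[S(h_{(1)}l_{(1)}^* )^*\cdot_\lambda y]\rangle\rtimes_\rho h_{(2)}l_{(2)}^*$, $\langle x\rtimes_\lambda h,y\rtimes_\lambda l\rangle_D=[h_{(1)}^*\cdot_\sigma\langle x,y\rangle_B]\rtimes_\sigma h_{(2)}^*l$. It is known that $Y$ is a $C-D$-equivalence bimodule. Identify $A$, $B$, $X$ with $A\rtimes_\rho 1$, $B\rtimes_\sigma 1$, $X\rtimes_\lambda 1$. The unital inclusions $A\subset C$ and $B\subset D$ are strongly Morita equivalent with respect to $Y$ and $X$, i.e. $a\cdot x\in X$, ${}_C\langle x,y\rangle\in A$, $x\cdot b\in X$, $\langle x,y\rangle_D\in B$ for $a\in A,b\in B,x,y\in X$, and ${}_C\langle X,X\rangle$, ${}_C\langle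 Y,X\rangle$, $\langle X,X\rangle_D$, $\langle Y,X\rangle_D$ span $A$, $C$, $B$, $D$ respectively. The Haar trace $\tau$ is the normalized Haar functional on $H$ (the unique state invariant under comultiplication; it is a trace). Conditional expectations for bimodules. Given conditional expectations $E^A:C\to A$, $E^B:D\to B$, a linear map $E^X$ from $Y$ onto $X$ is a conditional expectation from $Y$ onto $X$ with respect to $E^A$ and $E^B$ if: (1) $E^X(c\cdot x)=E^A(c)\cdot x$ for $c\in C$, $x\in X$; (2) $E^X(a\cdot y)=a\cdot E^X(y)$ for $a\in A$, $y\in Y$; (3) $E^A({}_C\langle y,x\rangle)={}_C\langle E^X(y),x\rangle$ for $x\in X$, $y\in Y$; (4) $E^X(x\cdot d)=x\cdot E^B(d)$ for $d\in D$, $x\in X$; (5) $E^X(y\cdot b)=E^X(y)\cdot b$ for $b\in B$, $y\in Y$; (6) $E^B(\langle y,x\rangle_D)=\langle E^X(y),x\rangle_D$ for $x\in X$, $y\in Y$. *)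

theory Defs
  imports "HOL-Analysis.Analysis" "HOL-Library.Multiset"
begin

section \<open>Complex vector spaces and C*-algebras\<close>

class complex_vector = ab_group_add +
  fixes scaleC :: "complex \<Rightarrow> 'a \<Rightarrow> 'a" (infixr "*\<^sub>C" 75)
  assumes scaleC_add_right: "c *\<^sub>C (x + y) = c *\<^sub>C x + c *\<^sub>C y"
    and scaleC_add_left: "(c + d) *\<^sub>C x = c *\<^sub>C x + d *\<^sub>C x"
    and scaleC_scaleC: "c *\<^sub>C d *\<^sub>C x = (c * d) *\<^sub>C x"
    and scaleC_one: "1 *\<^sub>C x = x"

global_interpretation cvec: vector_space "scaleC :: complex \<Rightarrow> 'a \<Rightarrow> 'a::complex_vector"
  defines cspan = cvec.span
  by unfold_locales (simp_all add: scaleC_add_right scaleC_add_left scaleC_scaleC scaleC_one)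

abbreviation clinear :: "('a::complex_vector \<Rightarrow> 'b::complex_vector) \<Rightarrow> bool"
  where "clinear f \<equiv> Vector_Spaces.linear scaleC scaleC f"

lemma clinear_iff:
  "clinear f \<longleftrightarrow> (\<forall>x y. f (x + y) = f x + f y) \<and> (\<forall>c x. f (c *\<^sub>C x) = c *\<^sub>C f x)"
  by (simp add: Vector_Spaces.linear_iff cvec.vector_space_axioms)

instantiation complex :: complex_vector
begin
definition scaleC_complex :: "complex \<Rightarrow> complex \<Rightarrow> complex" where "scaleC_complex = (*)"
instance by standard (simp_all add: scaleC_complex_def algebra_simps)
end

lemma scaleC_complex_apply: "c *\<^sub>C z = c * z" for z :: complex
  by (simp add: scaleC_complex_def)

class star =
  fixes star :: "'a \<Rightarrow> 'a"

text \<open>Unital complex *-algebras. The class \<^class>\<open>ring_1\<close> is avoided because it excludes the zero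
  algebra.\<close>

class star_algebra = complex_vector + ring + monoid_mult + star +
  assumes scaleC_mult_left: "(c *\<^sub>C x) * y = c *\<^sub>C (x * y)"
    and scaleC_mult_right: "x * (c *\<^sub>C y) = c *\<^sub>C (x * y)"
    and star_star: "star (star x) = x"
    and star_add: "star (x + y) = star x + star y"
    and star_scaleC: "star (c *\<^sub>C x) = cnj c *\<^sub>C star x"
    and star_mult: "star (x * y) = star y * star x"

class cstar_algebra = star_algebra + real_normed_algebra + banach +
  assumes scaleR_scaleC: "r *\<^sub>R x = complex_of_real r *\<^sub>C x"
    and norm_scaleC: "norm (c *\<^sub>C x) = cmod c * norm x"
    and cstar_identity: "norm (star x * x) = (norm x)\<^sup>2"

text \<open>The cone of finite sums of elements \<open>y\<^sup>* y\<close>, with the product and involution as parameters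
  since crossed products below do not carry the multiplication of a type class. In a C*-algebra a sum
  of such elements is again of the form \<open>y\<^sup>* y\<close>, so this is the usual positive cone.\<close>

definition positive_in :: "('c \<Rightarrow> 'c \<Rightarrow> 'c) \<Rightarrow> ('c \<Rightarrow> 'c) \<Rightarrow> 'c::monoid_add \<Rightarrow> bool"
  where "positive_in mul st x \<longleftrightarrow> (\<exists>ys. x = (\<Sum>y\<leftarrow>ys. mul (st y) y))"

abbreviation positive :: "'a::star_algebra \<Rightarrow> bool"
  where "positive \<equiv> positive_in (*) star"


section \<open>The algebraic tensor product\<close>

text \<open>Formal finite sums of pairs, modulo the congruence generated by bilinearity. The multisets
  form only a monoid, but the quotient is a vector space. All tensor products below have a
  finite-dimensional factor, so no completion is needed.\<close>

inductive tensor_eq :: "('a::complex_vector \<times> 'b::complex_vector) multiset \<Rightarrow> ('a \<times> 'b) multiset \<Rightarrow> bool"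
  where
    teq_refl: "tensor_eq M M"
  | teq_sym: "tensor_eq M N \<Longrightarrow> tensor_eq N M"
  | teq_trans: "tensor_eq L M \<Longrightarrow> tensor_eq M N \<Longrightarrow> tensor_eq L N"
  | teq_plus: "tensor_eq M N \<Longrightarrow> tensor_eq (L + M) (L + N)"
  | teq_add_left: "tensor_eq {#(a + a', b)#} {#(a, b), (a', b)#}"
  | teq_add_right: "tensor_eq {#(a, b + b')#} {#(a, b), (a, b')#}"
  | teq_scale: "tensor_eq {#(c *\<^sub>C a, b)#} {#(a, c *\<^sub>C b)#}"
  | teq_zero: "tensor_eq {#(0, b)#} {#}"

lemma teq_plus2: "tensor_eq M M' \<Longrightarrow> tensor_eq N N' \<Longrightarrow> tensor_eq (M + N) (M' + N')"
  by (metis add.commute teq_plus teq_trans)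

lemma equivp_tensor_eq: "equivp tensor_eq"
  by (rule equivpI; (rule reflpI sympI transpI; blast intro: tensor_eq.intros))

quotient_type (overloaded) ('a, 'b) tensor (infixr "\<otimes>" 72) =
  "('a::complex_vector \<times> 'b::complex_vector) multiset" / tensor_eq
  by (rule equivp_tensor_eq)

lemma tensor_eq_scale:
  assumes "tensor_eq M N"
  shows "tensor_eq (image_mset (\<lambda>(a, b). (c *\<^sub>C a, b)) M) (image_mset (\<lambda>(a, b). (c *\<^sub>C a, b)) N)"
  using assms
proof induction
  case (teq_scale d a b)
  show ?case
    using tensor_eq.teq_scale[of d "c *\<^sub>C a" b] by (simp add: scaleC_scaleC mult.commute)
qed (auto intro: tensor_eq.intros simp: scaleC_add_right)

lemma tensor_eq_neg:
  "tensor_eq (image_mset (\<lambda>(a, b). ((- 1) *\<^sub>C a, b)) M + M) {#}"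
proof (induction M)
  case (add p M)
  obtain a b where p: "p = (a, b)" by force
  have "tensor_eq {#((- 1) *\<^sub>C a, b), (a, b)#} {#((- 1) *\<^sub>C a + a, b)#}"
    by (rule teq_sym, rule teq_add_left)
  also have "(- 1) *\<^sub>C a + a = 0"
    by (simp add: cvec.scale_minus_left)
  finally have "tensor_eq {#((- 1) *\<^sub>C a, b), (a, b)#} {#}"
    using teq_zero teq_trans by metis
  from teq_plus2[OF this add] show ?case
    by (simp add: p add_mset_commute)
qed (simp add: teq_refl)

instantiation tensor :: (complex_vector, complex_vector) complex_vector
begin

lift_definition zero_tensor :: "'a \<otimes> 'b" is "{#}" .
lift_definition plus_tensor :: "'a \<otimes> 'b \<Rightarrow> 'a \<otimes> 'b \<Rightarrow> 'a \<otimes> 'b" is "(+)"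
  by (rule teq_plus2)
lift_definition scaleC_tensor :: "complex \<Rightarrow> 'a \<otimes> 'b \<Rightarrow> 'a \<otimes> 'b"
  is "\<lambda>c. image_mset (\<lambda>(a, b). (c *\<^sub>C a, b))"
  by (rule tensor_eq_scale)
definition uminus_tensor :: "'a \<otimes> 'b \<Rightarrow> 'a \<otimes> 'b" where "uminus_tensor t = (- 1) *\<^sub>C t"
definition minus_tensor :: "'a \<otimes> 'b \<Rightarrow> 'a \<otimes> 'b \<Rightarrow> 'a \<otimes> 'b" where "minus_tensor s t = s + - t"

instance
proof
  fix s t u :: "'a \<otimes> 'b" and c d :: complex
  show "s + t + u = s + (t + u)"
    by transfer (simp add: add.assoc teq_refl)
  show "s + t = t + s"
    by transfer (simp add: add.commute teq_refl)
  show "0 + s = s"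
    by transfer (simp add: teq_refl)
  show "- s + s = 0"
    unfolding uminus_tensor_def by transfer (rule tensor_eq_neg)
  show "s - t = s + - t"
    by (rule minus_tensor_def)
  show "c *\<^sub>C (s + t) = c *\<^sub>C s + c *\<^sub>C t"
    by transfer (simp add: teq_refl)
  show "(c + d) *\<^sub>C s = c *\<^sub>C s + d *\<^sub>C s"
  proof transfer
    fix c d :: complex and M :: "('a \<times> 'b) multiset"
    show "tensor_eq (image_mset (\<lambda>(a, b). ((c + d) *\<^sub>C a, b)) M)
      (image_mset (\<lambda>(a, b). (c *\<^sub>C a, b)) M + image_mset (\<lambda>(a, b). (d *\<^sub>C a, b)) M)"
    proof (induction M)
      case (add p M)
      obtain a b where p: "p = (a, b)" by force
      have "tensor_eq {#((c + d) *\<^sub>C a, b)#} {#(c *\<^sub>C a, b), (d *\<^sub>C a, b)#}"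
        by (simp add: scaleC_add_left teq_add_left)
      from teq_plus2[OF this add] show ?case
        by (simp add: p add_mset_commute)
    qed (simp add: teq_refl)
  qed
  show "c *\<^sub>C d *\<^sub>C s = (c * d) *\<^sub>C s"
    by transfer (simp add: multiset.map_comp o_def case_prod_beta' scaleC_scaleC teq_refl)
  show "1 *\<^sub>C s = s"
    by transfer (simp add: scaleC_one case_prod_beta' teq_refl)
qed

end

lift_definition tprod :: "'a::complex_vector \<Rightarrow> 'b::complex_vector \<Rightarrow> 'a \<otimes> 'b" (infixr "\<otimes>" 72)
  is "\<lambda>a b. {#(a, b)#}" .

text \<open>\<open>tlift f (\<Sum>\<^sub>i a\<^sub>i \<otimes> b\<^sub>i) = \<Sum>\<^sub>i f a\<^sub>i b\<^sub>i\<close>. This is independent of the representation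
  precisely for balanced \<open>f\<close>, which covers maps that are bilinear and maps that are conjugate linear
  in both arguments. A Sweedler sum \<open>f h\<^sub>(\<^sub>1\<^sub>) h\<^sub>(\<^sub>2\<^sub>)\<close> is \<open>tlift f (comult h)\<close>.\<close>

definition tlift :: "('a::complex_vector \<Rightarrow> 'b::complex_vector \<Rightarrow> 'c::comm_monoid_add) \<Rightarrow> 'a \<otimes> 'b \<Rightarrow> 'c"
  where "tlift f t = (\<Sum>(a, b)\<in>#rep_tensor t. f a b)"

definition balanced :: "('a::complex_vector \<Rightarrow> 'b::complex_vector \<Rightarrow> 'c::comm_monoid_add) \<Rightarrow> bool"
  where "balanced f \<longleftrightarrow>
    (\<forall>a a' b. f (a + a') b = f a b + f a' b) \<and>
    (\<forall>a b b'. f a (b + b') = f a b + f a b') \<and>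
    (\<forall>c a b. f (c *\<^sub>C a) b = f a (c *\<^sub>C b)) \<and>
    (\<forall>b. f 0 b = 0)"

lemma balanced_tensor_eq:
  assumes "balanced f" and "tensor_eq M N"
  shows "(\<Sum>(a, b)\<in>#M. f a b) = (\<Sum>(a, b)\<in>#N. f a b)"
  using assms(2) by induction (use assms(1) in \<open>auto simp: balanced_def\<close>)

lemma tlift_abs:
  assumes "balanced f"
  shows "tlift f (abs_tensor M) = (\<Sum>(a, b)\<in>#M. f a b)"
  unfolding tlift_def
  by (intro balanced_tensor_eq[OF assms])
    (metis Quotient3_tensor rep_abs_rsp_left teq_refl Quotient3_abs_rep Quotient3_rel_abs tensor.abs_eq_iff Quotient_abs_rep Quotient_tensor)

lemma tlift_tprod: "balanced f \<Longrightarrow> tlift f (a \<otimes> b) = f a b"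
  by (simp add: tprod.abs_eq tlift_abs)

lemma tlift_add: "balanced f \<Longrightarrow> tlift f (s + t) = tlift f s + tlift f t"
  by (induction s rule: tensor.abs_induct, induction t rule: tensor.abs_induct)
    (simp add: tlift_abs plus_tensor.abs_eq)

lemma tlift_zero: "balanced f \<Longrightarrow> tlift f 0 = 0"
  by (simp add: tlift_abs zero_tensor.abs_eq)

lemma tensor_induct [case_names zero add]:
  assumes "P 0" and "\<And>a b t. P t \<Longrightarrow> P (a \<otimes> b + t)"
  shows "P t"
proof (induction t rule: tensor.abs_induct)
  case (1 M)
  show ?case
  proof (induction M)
    case empty
    then show ?case using assms(1) by (simp add: zero_tensor.abs_eq)
  next
    case (add p M)
    then show ?case
      using assms(2)[of "abs_tensor M" "fst p" "snd p"]
      by (simp add: tprod.abs_eq plus_tensor.abs_eq)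
  qed
qed

lemma tprod_add_left: "(a + a') \<otimes> b = a \<otimes> b + a' \<otimes> b"
  by transfer (metis add_mset_add_single add_mset_commute teq_add_left)

lemma tprod_add_right: "a \<otimes> (b + b') = a \<otimes> b + a \<otimes> b'"
  by transfer (metis add_mset_add_single add_mset_commute teq_add_right)

lemma tprod_scaleC_left: "(c *\<^sub>C a) \<otimes> b = c *\<^sub>C (a \<otimes> b)"
  by transfer (simp add: teq_refl)

lemma tprod_scaleC_right: "a \<otimes> (c *\<^sub>C b) = c *\<^sub>C (a \<otimes> b)"
  by transfer (simp add: teq_scale teq_sym)

lemma tprod_zero_left: "0 \<otimes> b = 0"
  by transfer (rule teq_zero)

lemma tlift_scaleC:
  assumes "balanced f" and "\<And>a b. f (c *\<^sub>C a) b = d *\<^sub>C f a b"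
  shows "tlift f (c *\<^sub>C t) = d *\<^sub>C tlift f t"
  by (induction t rule: tensor_induct)
    (simp_all add: assms tlift_add tlift_zero tlift_tprod scaleC_add_right
      tprod_scaleC_left[symmetric])

lemma clinear_tlift:
  assumes "\<And>b. clinear (\<lambda>a. f a b)" and "\<And>a. clinear (f a)"
  shows "balanced f" and "clinear (tlift f)"
proof -
  have "f 0 b = 0" for b
    using assms(1)[of b] unfolding clinear_iff by (metis cvec.scale_zero_left)
  then show bal: "balanced f"
    using assms by (simp add: balanced_def clinear_iff)
  show "clinear (tlift f)"
    using assms(1) by (auto simp: clinear_iff tlift_add bal intro: tlift_scaleC)
qed

definition tmap :: "('a::complex_vector \<Rightarrow> 'c::complex_vector) \<Rightarrow> ('b::complex_vector \<Rightarrow> 'd::complex_vector)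
    \<Rightarrow> 'a \<otimes> 'b \<Rightarrow> 'c \<otimes> 'd"
  where "tmap f g = tlift (\<lambda>a b. f a \<otimes> g b)"

definition tassoc :: "('a::complex_vector \<otimes> 'b::complex_vector) \<otimes> 'c::complex_vector \<Rightarrow> 'a \<otimes> 'b \<otimes> 'c"
  where "tassoc = tlift (\<lambda>t c. tlift (\<lambda>a b. a \<otimes> b \<otimes> c) t)"

text \<open>\<open>id \<otimes> \<phi>\<close> and \<open>\<phi> \<otimes> id\<close> for a functional \<open>\<phi>\<close>, where \<open>V \<otimes> \<complex>\<close> and \<open>\<complex> \<otimes> V\<close> are identified
  with \<open>V\<close>.\<close>

definition rslice :: "('b::complex_vector \<Rightarrow> complex) \<Rightarrow> 'a::complex_vector \<otimes> 'b \<Rightarrow> 'a"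
  where "rslice \<phi> = tlift (\<lambda>a b. \<phi> b *\<^sub>C a)"

definition lslice :: "('a::complex_vector \<Rightarrow> complex) \<Rightarrow> 'a \<otimes> 'b::complex_vector \<Rightarrow> 'b"
  where "lslice \<phi> = tlift (\<lambda>a b. \<phi> a *\<^sub>C b)"

text \<open>\<open>(a \<otimes> b) \<cdot> (a' \<otimes> b') = p a a' \<otimes> q b b'\<close> for bilinear \<open>p\<close> and \<open>q\<close>; also used when both are
  sesquilinear.\<close>

definition tmap2 :: "('a \<Rightarrow> 'c \<Rightarrow> 'e) \<Rightarrow> ('b \<Rightarrow> 'd \<Rightarrow> 'f) \<Rightarrow> 'a::complex_vector \<otimes> 'b::complex_vector
    \<Rightarrow> 'c::complex_vector \<otimes> 'd::complex_vector \<Rightarrow> 'e::complex_vector \<otimes> 'f::complex_vector"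
  where "tmap2 p q s t = tlift (\<lambda>a b. tlift (\<lambda>c d. p a c \<otimes> q b d) t) s"

instantiation tensor :: ("{complex_vector, times}", "{complex_vector, times}") times
begin
definition times_tensor :: "'a \<otimes> 'b \<Rightarrow> 'a \<otimes> 'b \<Rightarrow> 'a \<otimes> 'b" where "times_tensor = tmap2 (*) (*)"
instance ..
end

instantiation tensor :: ("{complex_vector, one}", "{complex_vector, one}") one
begin
definition one_tensor :: "'a \<otimes> 'b" where "1 = (1 :: 'a) \<otimes> (1 :: 'b)"
instance ..
end

instantiation tensor :: ("{complex_vector, star}", "{complex_vector, star}") star
begin
definition star_tensor :: "'a \<otimes> 'b \<Rightarrow> 'a \<otimes> 'b" where "star = tmap star star"
instance ..
end


section \<open>Finite-dimensional C*-Hopf algebras and their duals\<close>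

class hopf_structure = complex_vector +
  fixes comult :: "'a \<Rightarrow> 'a \<otimes> 'a"
    and counit :: "'a \<Rightarrow> complex"
    and antipode :: "'a \<Rightarrow> 'a"

text \<open>The axioms form a locale, since a class cannot state the linearity of its own
  comultiplication.\<close>

locale cstar_hopf_algebra =
  fixes H :: "'h::{cstar_algebra, hopf_structure} itself"
  assumes finite_dimensional: "\<exists>B :: 'h set. finite B \<and> cspan B = UNIV"
    and comult_linear: "clinear (comult :: 'h \<Rightarrow> 'h \<otimes> 'h)"
    and comult_mult: "\<And>g h :: 'h. comult (g * h) = comult g * comult h"
    and comult_one: "comult (1 :: 'h) = 1"
    and comult_star: "\<And>h :: 'h. comult (star h) = star (comult h)"
    and comult_coassoc: "\<And>h :: 'h. tassoc (tmap comult id (comult h)) = tmap id comult (comult h)"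
    and counit_linear: "clinear (counit :: 'h \<Rightarrow> complex)"
    and counit_mult: "\<And>g h :: 'h. counit (g * h) = counit g * counit h"
    and counit_one: "counit (1 :: 'h) = 1"
    and counit_star: "\<And>h :: 'h. counit (star h) = cnj (counit h)"
    and counit_left: "\<And>h :: 'h. lslice counit (comult h) = h"
    and counit_right: "\<And>h :: 'h. rslice counit (comult h) = h"
    and antipode_linear: "clinear (antipode :: 'h \<Rightarrow> 'h)"
    and antipode_left: "\<And>h :: 'h. tlift (\<lambda>x y. antipode x * y) (comult h) = counit h *\<^sub>C 1"
    and antipode_right: "\<And>h :: 'h. tlift (\<lambda>x y. x * antipode y) (comult h) = counit h *\<^sub>C 1"
    and antipode_star: "\<And>h :: 'h. antipode (star (antipode (star h))) = h"

typedef (overloaded) 'h dual = "{\<phi> :: 'h::complex_vector \<Rightarrow> complex. clinear \<phi>}"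
  morphisms dual_apply Abs_dual
  by (rule exI[of _ "\<lambda>_. 0"]) (simp add: clinear_iff scaleC_complex_apply)

setup_lifting type_definition_dual

instantiation dual :: (complex_vector) complex_vector
begin
lift_definition zero_dual :: "'a dual" is "\<lambda>_. 0"
  by (simp add: clinear_iff scaleC_complex_apply)
lift_definition plus_dual :: "'a dual \<Rightarrow> 'a dual \<Rightarrow> 'a dual" is "\<lambda>\<phi> \<psi> h. \<phi> h + \<psi> h"
  by (simp add: clinear_iff scaleC_complex_apply algebra_simps)
lift_definition minus_dual :: "'a dual \<Rightarrow> 'a dual \<Rightarrow> 'a dual" is "\<lambda>\<phi> \<psi> h. \<phi> h - \<psi> h"
  by (simp add: clinear_iff scaleC_complex_apply algebra_simps)
lift_definition uminus_dual :: "'a dual \<Rightarrow> 'a dual" is "\<lambda>\<phi> h. - \<phi> h"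
  by (simp add: clinear_iff scaleC_complex_apply)
lift_definition scaleC_dual :: "complex \<Rightarrow> 'a dual \<Rightarrow> 'a dual" is "\<lambda>c \<phi> h. c * \<phi> h"
  by (simp add: clinear_iff scaleC_complex_apply algebra_simps)
instance
  by standard (transfer; simp add: fun_eq_iff algebra_simps)+
end

text \<open>The dual C*-Hopf algebra \<open>H\<^sup>0\<close>: \<open>(\<phi> \<psi>)(h) = \<phi> h\<^sub>(\<^sub>1\<^sub>) \<psi> h\<^sub>(\<^sub>2\<^sub>)\<close>, the unit is the counit of \<open>H\<close>,
  \<open>\<phi>\<^sup>*(h) = cnj (\<phi> (S(h)\<^sup>*))\<close>, \<open>\<Delta>\<^sup>0(\<phi>)(h \<otimes> l) = \<phi> (h l)\<close> and \<open>\<epsilon>\<^sup>0(\<phi>) = \<phi> 1\<close>. The functionals passed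
  to \<open>Abs_dual\<close> are linear by the axioms of a C*-Hopf algebra, see below.\<close>

instantiation dual :: (hopf_structure) "{times, one}"
begin
definition times_dual :: "'a dual \<Rightarrow> 'a dual \<Rightarrow> 'a dual" where
  "\<phi> * \<psi> = Abs_dual (\<lambda>h. tlift (\<lambda>x y. dual_apply \<phi> x * dual_apply \<psi> y) (comult h))"
definition one_dual :: "'a dual" where "1 = Abs_dual counit"
instance ..
end

instantiation dual :: ("{star, hopf_structure}") star
begin
definition star_dual :: "'a dual \<Rightarrow> 'a dual" where
  "star \<phi> = Abs_dual (\<lambda>h. cnj (dual_apply \<phi> (star (antipode h))))"
instance ..
end

definition dual_pairing :: "'h::complex_vector dual \<otimes> 'h dual \<Rightarrow> 'h \<Rightarrow> 'h \<Rightarrow> complex" where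
  "dual_pairing t h l = tlift (\<lambda>\<phi> \<psi>. dual_apply \<phi> h * dual_apply \<psi> l) t"

definition dual_comult :: "'h::{complex_vector, times} dual \<Rightarrow> 'h dual \<otimes> 'h dual" where
  "dual_comult \<phi> = (THE t. \<forall>h l. dual_pairing t h l = dual_apply \<phi> (h * l))"

definition dual_counit :: "'h::{complex_vector, one} dual \<Rightarrow> complex" where
  "dual_counit \<phi> = dual_apply \<phi> 1"

lemma clinear_dual_apply: "clinear (dual_apply \<phi>)"
  using dual_apply by blast

lemma dual_pairing_balanced: "balanced (\<lambda>\<phi> \<psi>. dual_apply \<phi> h * dual_apply \<psi> l)"
  and dual_pairing_linear: "clinear (\<lambda>t. dual_pairing t h l)"
proof -
  have "clinear (\<lambda>\<phi>. dual_apply \<phi> h * dual_apply \<psi> l)"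
    and "clinear (\<lambda>\<phi>. dual_apply \<psi> h * dual_apply \<phi> l)" for \<psi> h l
    by (simp_all add: clinear_iff plus_dual.rep_eq scaleC_dual.rep_eq scaleC_complex_apply algebra_simps)
  note * = clinear_tlift[of "\<lambda>\<phi> \<psi>. dual_apply \<phi> h * dual_apply \<psi> l", OF this]
  show "balanced (\<lambda>\<phi> \<psi>. dual_apply \<phi> h * dual_apply \<psi> l)"
    by (rule *)
  show "clinear (\<lambda>t. dual_pairing t h l)"
    unfolding dual_pairing_def by (rule *)
qed

context cstar_hopf_algebra
begin

lemma dual_apply_times:
  "dual_apply (\<phi> * \<psi>) (h :: 'h) = tlift (\<lambda>x y. dual_apply \<phi> x * dual_apply \<psi> y) (comult h)"
proof -
  have "clinear (tlift (\<lambda>x y. dual_apply \<phi> x * dual_apply \<psi> y))"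
    using clinear_dual_apply[of \<phi>] clinear_dual_apply[of \<psi>]
    by (intro clinear_tlift) (auto simp: clinear_iff scaleC_complex_apply algebra_simps)
  then have "clinear (\<lambda>h :: 'h. tlift (\<lambda>x y. dual_apply \<phi> x * dual_apply \<psi> y) (comult h))"
    using comult_linear by (simp add: clinear_iff)
  then show ?thesis
    by (simp add: times_dual_def Abs_dual_inverse)
qed

lemma dual_apply_one: "dual_apply 1 (h :: 'h) = counit h"
  by (simp add: one_dual_def Abs_dual_inverse counit_linear)

lemma dual_apply_star: "dual_apply (star \<phi>) (h :: 'h) = cnj (dual_apply \<phi> (star (antipode h)))"
proof -
  have "clinear (\<lambda>h :: 'h. cnj (dual_apply \<phi> (star (antipode h))))"
    using antipode_linear clinear_dual_apply[of \<phi>]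
    by (simp add: clinear_iff star_add star_scaleC scaleC_complex_apply)
  then show ?thesis
    by (simp add: star_dual_def Abs_dual_inverse)
qed

lemma dual_basis:
  obtains B :: "'h set" and \<beta> :: "'h \<Rightarrow> 'h dual"
  where "finite B" and "\<And>h. h = (\<Sum>b\<in>B. dual_apply (\<beta> b) h *\<^sub>C b)"
    and "\<And>\<phi>. \<phi> = (\<Sum>b\<in>B. dual_apply \<phi> b *\<^sub>C \<beta> b)"
proof -
  obtain G :: "'h set" where G: "finite G" "cspan G = UNIV"
    using finite_dimensional by blast
  obtain B where B: "B \<subseteq> G" "\<not> cvec.dependent B" "G \<subseteq> cvec.span B"
    by (rule cvec.maximal_independent_subset)
  have fin: "finite B" using B(1) G(1) finite_subset by blast
  have sp: "cvec.span B = UNIV"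
    using B(3) G(2) cvec.span_minimal[OF B(3)] by auto
  define \<beta> where "\<beta> b = Abs_dual (\<lambda>h. cvec.representation B h b)" for b
  have \<beta>: "dual_apply (\<beta> b) h = cvec.representation B h b" for b h
    unfolding \<beta>_def using B(2) sp
    by (subst Abs_dual_inverse)
      (auto simp: clinear_iff scaleC_complex_apply cvec.representation_add cvec.representation_scale)
  have 1: "h = (\<Sum>b\<in>B. dual_apply (\<beta> b) h *\<^sub>C b)" for h
    unfolding \<beta> using cvec.sum_representation_eq[of B h B] B(2) sp fin by simp
  have "\<phi> = (\<Sum>b\<in>B. dual_apply \<phi> b *\<^sub>C \<beta> b)" for \<phi>
  proof -
    have sum: "dual_apply (\<Sum>b\<in>F. f b) h = (\<Sum>b\<in>F. dual_apply (f b) h)" if "finite F"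
      for f :: "'h \<Rightarrow> 'h dual" and F h
      using that by (induction F) (simp_all add: zero_dual.rep_eq plus_dual.rep_eq)
    have "dual_apply \<phi> h = dual_apply (\<Sum>b\<in>B. dual_apply \<phi> b *\<^sub>C \<beta> b) h" for h
    proof -
      have "dual_apply \<phi> h = (\<Sum>b\<in>B. dual_apply \<phi> (dual_apply (\<beta> b) h *\<^sub>C b))"
        by (subst 1) (rule module_hom.sum[OF clinear_dual_apply[unfolded linear_iff_module_hom]])
      also have "\<dots> = (\<Sum>b\<in>B. dual_apply (\<beta> b) h * dual_apply \<phi> b)"
        using clinear_dual_apply[of \<phi>] by (simp add: clinear_iff scaleC_complex_apply)
      finally show ?thesis
        by (simp add: sum[OF fin] scaleC_dual.rep_eq mult.commute)
    qed
    then show ?thesis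
      by (intro dual_apply_inject[THEN iffD1] ext)
  qed
  with fin 1 show thesis by (rule that)
qed

lemma dual_pairing_dual_comult: "dual_pairing (dual_comult \<phi>) h l = dual_apply \<phi> (h * l :: 'h)"
proof -
  obtain B :: "'h set" and \<beta> where fin: "finite B"
    and expand: "\<And>h. h = (\<Sum>b\<in>B. dual_apply (\<beta> b) h *\<^sub>C b)"
    and expand_dual: "\<And>\<phi>. \<phi> = (\<Sum>b\<in>B. dual_apply \<phi> b *\<^sub>C \<beta> b)"
    by (rule dual_basis) blast
  have pair_sum: "dual_pairing (\<Sum>b\<in>F. f b) h l = (\<Sum>b\<in>F. dual_pairing (f b) h l)"
    for f :: "'h \<Rightarrow> _" and F and h l :: 'h
    by (rule module_hom.sum[OF dual_pairing_linear[unfolded linear_iff_module_hom]])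
  have pair_scale: "dual_pairing (c *\<^sub>C t) h l = c * dual_pairing t h l" for c t and h l :: 'h
    using dual_pairing_linear[of h l] by (simp add: clinear_iff scaleC_complex_apply)
  have pair_tprod: "dual_pairing (\<phi> \<otimes> \<psi>) h l = dual_apply \<phi> h * dual_apply \<psi> l"
    for \<phi> \<psi> and h l :: 'h
    by (simp add: dual_pairing_def tlift_tprod dual_pairing_balanced)
  have tsum_left: "(\<Sum>b\<in>F. f b) \<otimes> \<psi> = (\<Sum>b\<in>F. f b \<otimes> \<psi>)" if "finite F"
    for f :: "'h \<Rightarrow> 'h dual" and F and \<psi> :: "'h dual"
    using that by (induction F) (simp_all add: tprod_zero_left tprod_add_left)
  have tsum_right: "\<psi> \<otimes> (\<Sum>b\<in>F. f b) = (\<Sum>b\<in>F. \<psi> \<otimes> f b)" if "finite F"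
    for f :: "'h \<Rightarrow> 'h dual" and F and \<psi> :: "'h dual"
    using that
    by (induction F) (simp_all add: tprod_add_right,
      metis cvec.scale_zero_left tprod_scaleC_right)
  have tensor_expand: "t = (\<Sum>b\<in>B. \<Sum>c\<in>B. dual_pairing t b c *\<^sub>C (\<beta> b \<otimes> \<beta> c))" for t
  proof (induction t rule: tensor_induct)
    case zero
    have "dual_pairing 0 b c = 0" for b c :: 'h
      by (simp add: dual_pairing_def tlift_zero dual_pairing_balanced)
    then show ?case by simp
  next
    case (add \<phi> \<psi> t)
    have pa: "dual_pairing (s + t) b c = dual_pairing s b c + dual_pairing t b c" for s t and b c :: 'h
      using dual_pairing_linear[of b c] by (simp add: clinear_iff)
    have "\<phi> \<otimes> \<psi> = (\<Sum>b\<in>B. \<Sum>c\<in>B. (dual_apply \<phi> b * dual_apply \<psi> c) *\<^sub>C (\<beta> b \<otimes> \<beta> c))"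
      by (subst expand_dual[of \<phi>], subst expand_dual[of \<psi>])
        (simp add: fin tsum_left tsum_right tprod_scaleC_left tprod_scaleC_right
          cvec.scale_sum_right mult.commute, rule sum.swap)
    then have "\<phi> \<otimes> \<psi> + t = (\<Sum>b\<in>B. \<Sum>c\<in>B. (dual_apply \<phi> b * dual_apply \<psi> c) *\<^sub>C (\<beta> b \<otimes> \<beta> c))
        + (\<Sum>b\<in>B. \<Sum>c\<in>B. dual_pairing t b c *\<^sub>C (\<beta> b \<otimes> \<beta> c))"
      by (rule arg_cong2[OF _ add])
    also have "\<dots> = (\<Sum>b\<in>B. \<Sum>c\<in>B. dual_pairing (\<phi> \<otimes> \<psi> + t) b c *\<^sub>C (\<beta> b \<otimes> \<beta> c))"
      by (simp add: pa pair_tprod scaleC_add_left sum.distrib)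
    finally show ?case .
  qed
  define t0 where "t0 = (\<Sum>b\<in>B. \<Sum>c\<in>B. dual_apply \<phi> (b * c) *\<^sub>C (\<beta> b \<otimes> \<beta> c))"
  have ex: "dual_pairing t0 h l = dual_apply \<phi> (h * l)" for h l
  proof -
    have phi_sum: "dual_apply \<phi> (\<Sum>b\<in>F. f b) = (\<Sum>b\<in>F. dual_apply \<phi> (f b))" for F and f :: "'h \<Rightarrow> 'h"
      by (rule module_hom.sum[OF clinear_dual_apply[unfolded linear_iff_module_hom]])
    have phi_scale: "dual_apply \<phi> (c *\<^sub>C x) = c * dual_apply \<phi> x" for c x
      using clinear_dual_apply[of \<phi>] by (simp add: clinear_iff scaleC_complex_apply)
    have "h * l = (\<Sum>b\<in>B. \<Sum>c\<in>B. (dual_apply (\<beta> b) h * dual_apply (\<beta> c) l) *\<^sub>C (b * c))"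
      by (subst expand[of h], subst expand[of l])
        (simp add: sum_product scaleC_mult_left scaleC_mult_right mult.commute)
    then have "dual_apply \<phi> (h * l) =
        (\<Sum>b\<in>B. \<Sum>c\<in>B. (dual_apply (\<beta> b) h * dual_apply (\<beta> c) l) * dual_apply \<phi> (b * c))"
      by (simp only: phi_sum phi_scale)
    then show ?thesis
      by (simp add: t0_def pair_sum pair_scale pair_tprod mult.commute)
  qed
  have "dual_comult \<phi> = t0"
    unfolding dual_comult_def
  proof (rule the_equality)
    show "\<forall>h l. dual_pairing t0 h l = dual_apply \<phi> (h * l)" using ex by blast
    fix t assume "\<forall>h l. dual_pairing t h l = dual_apply \<phi> (h * l)"
    then show "t = t0" by (subst tensor_expand) (simp add: t0_def)
  qed
  with ex show ?thesis by simp
qed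

end

text \<open>The Haar functional is unique, so a statement about every \<open>\<tau>\<close> with this property is a statement
  about the Haar trace.\<close>

definition haar_trace :: "('h::{cstar_algebra, hopf_structure} \<Rightarrow> complex) \<Rightarrow> bool" where
  "haar_trace \<tau> \<longleftrightarrow>
    clinear \<tau> \<and> \<tau> 1 = 1 \<and> (\<forall>h. \<tau> (star h * h) \<in> \<real>\<^sub>\<ge>\<^sub>0) \<and>
    (\<forall>h. rslice \<tau> (comult h) = \<tau> h *\<^sub>C 1) \<and> (\<forall>h. lslice \<tau> (comult h) = \<tau> h *\<^sub>C 1)"


section \<open>Equivalence bimodules\<close>

locale full_left_hilbert_module =
  fixes lact :: "'a::cstar_algebra \<Rightarrow> 'x::complex_vector \<Rightarrow> 'x"
    and lip :: "'x \<Rightarrow> 'x \<Rightarrow> 'a"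
  assumes lact_linear_left: "clinear (\<lambda>a. lact a x)"
    and lact_linear_right: "clinear (lact a)"
    and lact_mult: "lact (a * a') x = lact a (lact a' x)"
    and lact_one: "lact 1 x = x"
    and lip_linear: "clinear (\<lambda>x. lip x y)"
    and lip_star: "star (lip x y) = lip y x"
    and lip_lact: "lip (lact a x) y = a * lip x y"
    and lip_positive: "positive (lip x x)"
    and lip_definite: "lip x x = 0 \<Longrightarrow> x = 0"
    and lip_complete:
      "(\<forall>e>0. \<exists>N. \<forall>m\<ge>N. \<forall>n\<ge>N. sqrt (norm (lip (u m - u n) (u m - u n))) < e) \<Longrightarrow>
       \<exists>x. (\<lambda>n. sqrt (norm (lip (u n - x) (u n - x)))) \<longlonglongrightarrow> 0"
    and lip_full: "closure (cspan {lip x y |x y. True}) = UNIV"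

locale full_right_hilbert_module =
  fixes ract :: "'x::complex_vector \<Rightarrow> 'b::cstar_algebra \<Rightarrow> 'x"
    and rip :: "'x \<Rightarrow> 'x \<Rightarrow> 'b"
  assumes ract_linear_left: "clinear (\<lambda>x. ract x b)"
    and ract_linear_right: "clinear (ract x)"
    and ract_mult: "ract x (b * b') = ract (ract x b) b'"
    and ract_one: "ract x 1 = x"
    and rip_linear: "clinear (rip x)"
    and rip_star: "star (rip x y) = rip y x"
    and rip_ract: "rip x (ract y b) = rip x y * b"
    and rip_positive: "positive (rip x x)"
    and rip_definite: "rip x x = 0 \<Longrightarrow> x = 0"
    and rip_complete:
      "(\<forall>e>0. \<exists>N. \<forall>m\<ge>N. \<forall>n\<ge>N. sqrt (norm (rip (u m - u n) (u m - u n))) < e) \<Longrightarrow>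
       \<exists>x. (\<lambda>n. sqrt (norm (rip (u n - x) (u n - x)))) \<longlonglongrightarrow> 0"
    and rip_full: "closure (cspan {rip x y |x y. True}) = UNIV"

locale equivalence_bimodule =
  full_left_hilbert_module lact lip + full_right_hilbert_module ract rip
  for lact :: "'a::cstar_algebra \<Rightarrow> 'x::complex_vector \<Rightarrow> 'x"
    and ract :: "'x \<Rightarrow> 'b::cstar_algebra \<Rightarrow> 'x"
    and lip :: "'x \<Rightarrow> 'x \<Rightarrow> 'a"
    and rip :: "'x \<Rightarrow> 'x \<Rightarrow> 'b" +
  assumes lact_ract: "ract (lact a x) b = lact a (ract x b)"
    and lip_ract_adjoint: "lip (ract x b) y = lip x (ract y (star b))"
    and rip_lact_adjoint: "rip (lact a x) y = rip x (lact (star a) y)"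
    and imprimitivity: "lact (lip x y) z = ract x (rip y z)"


section \<open>Coactions\<close>

definition coassociative ::
    "('v::complex_vector \<Rightarrow> 'v \<otimes> 'h::{cstar_algebra, hopf_structure} dual) \<Rightarrow> bool" where
  "coassociative \<kappa> \<longleftrightarrow> (\<forall>v. tassoc (tmap \<kappa> id (\<kappa> v)) = tmap id dual_comult (\<kappa> v))"

definition counital ::
    "('v::complex_vector \<Rightarrow> 'v \<otimes> 'h::{cstar_algebra, hopf_structure} dual) \<Rightarrow> bool" where
  "counital \<kappa> \<longleftrightarrow> (\<forall>v. rslice dual_counit (\<kappa> v) = v)"

definition coaction ::
    "('a::cstar_algebra \<Rightarrow> 'a \<otimes> 'h::{cstar_algebra, hopf_structure} dual) \<Rightarrow> bool" where
  "coaction \<rho> \<longleftrightarrow>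
    clinear \<rho> \<and> \<rho> 1 = 1 \<and> (\<forall>a b. \<rho> (a * b) = \<rho> a * \<rho> b) \<and> (\<forall>a. \<rho> (star a) = star (\<rho> a)) \<and>
    coassociative \<rho> \<and> counital \<rho>"

text \<open>\<open>X \<otimes> H\<^sup>0\<close> is the \<open>(A \<otimes> H\<^sup>0)\<close>-\<open>(B \<otimes> H\<^sup>0)\<close>-bimodule obtained from \<open>X\<close> and the standard
  \<open>H\<^sup>0\<close>-\<open>H\<^sup>0\<close>-bimodule \<open>H\<^sup>0\<close> with inner products \<open>\<phi> \<psi>\<^sup>*\<close> and \<open>\<phi>\<^sup>* \<psi>\<close>.\<close>

definition bimodule_coaction ::
    "('a::cstar_algebra \<Rightarrow> 'x::complex_vector \<Rightarrow> 'x) \<Rightarrow> ('x \<Rightarrow> 'b::cstar_algebra \<Rightarrow> 'x) \<Rightarrow>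
     ('x \<Rightarrow> 'x \<Rightarrow> 'a) \<Rightarrow> ('x \<Rightarrow> 'x \<Rightarrow> 'b) \<Rightarrow>
     ('a \<Rightarrow> 'a \<otimes> 'h::{cstar_algebra, hopf_structure} dual) \<Rightarrow> ('b \<Rightarrow> 'b \<otimes> 'h dual) \<Rightarrow>
     ('x \<Rightarrow> 'x \<otimes> 'h dual) \<Rightarrow> bool" where
  "bimodule_coaction lact ract lip rip \<rho> \<sigma> \<xi> \<longleftrightarrow>
    clinear \<xi> \<and>
    (\<forall>a x. \<xi> (lact a x) = tmap2 lact (*) (\<rho> a) (\<xi> x)) \<and>
    (\<forall>x b. \<xi> (ract x b) = tmap2 ract (*) (\<xi> x) (\<sigma> b)) \<and>
    (\<forall>x y. \<rho> (lip x y) = tmap2 lip (\<lambda>\<phi> \<psi>. \<phi> * star \<psi>) (\<xi> x) (\<xi> y)) \<and>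
    (\<forall>x y. \<sigma> (rip x y) = tmap2 rip (\<lambda>\<phi> \<psi>. star \<phi> * \<psi>) (\<xi> x) (\<xi> y)) \<and>
    counital \<xi> \<and> coassociative \<xi>"

definition induced_action ::
    "('v::complex_vector \<Rightarrow> 'v \<otimes> 'h::complex_vector dual) \<Rightarrow> 'h \<Rightarrow> 'v \<Rightarrow> 'v" where
  "induced_action \<kappa> h v = rslice (\<lambda>\<phi>. dual_apply \<phi> h) (\<kappa> v)"


section \<open>Crossed products\<close>

text \<open>The crossed products of \<open>A\<close>, \<open>B\<close> and \<open>X\<close> have underlying spaces \<open>A \<otimes> H\<close>, \<open>B \<otimes> H\<close> and \<open>X \<otimes> H\<close>.
  For \<open>p\<close> equal to the product of \<open>A\<close>, the left action on \<open>X\<close>, or the right action on \<open>X\<close>,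
  and \<open>\<kappa>\<close> equal to \<open>\<rho>\<close>, \<open>\<lambda>\<close>, or \<open>\<sigma>\<close>, the operation
  \<open>(v \<rtimes> h) \<cdot> (w \<rtimes> l) = p v (h\<^sub>(\<^sub>1\<^sub>) \<cdot>\<^sub>\<kappa> w) \<rtimes> h\<^sub>(\<^sub>2\<^sub>) l\<close> is the product of \<open>A \<rtimes> H\<close>, the left action
  of \<open>A \<rtimes> H\<close> on \<open>X \<rtimes> H\<close>, or the right action of \<open>B \<rtimes> H\<close> on \<open>X \<rtimes> H\<close>.\<close>

definition crossed_mult ::
    "('v \<Rightarrow> 'w \<Rightarrow> 'u) \<Rightarrow> ('w \<Rightarrow> 'w \<otimes> 'h dual) \<Rightarrow> 'v::complex_vector \<otimes> 'h::{cstar_algebra, hopf_structure}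
     \<Rightarrow> 'w::complex_vector \<otimes> 'h \<Rightarrow> 'u::complex_vector \<otimes> 'h" where
  "crossed_mult p \<kappa> s t =
    tlift (\<lambda>v h. tlift (\<lambda>w l.
      tlift (\<lambda>h1 h2. p v (induced_action \<kappa> h1 w) \<otimes> (h2 * l)) (comult h)) t) s"

definition crossed_star ::
    "('a \<Rightarrow> 'a \<otimes> 'h dual) \<Rightarrow> 'a::cstar_algebra \<otimes> 'h::{cstar_algebra, hopf_structure} \<Rightarrow> 'a \<otimes> 'h" where
  "crossed_star \<rho> =
    tlift (\<lambda>a h. tlift (\<lambda>h1 h2. induced_action \<rho> (star h1) (star a) \<otimes> star h2) (comult h))"

definition crossed_lip ::
    "('x \<Rightarrow> 'x \<Rightarrow> 'a) \<Rightarrow> ('x \<Rightarrow> 'x \<otimes> 'h dual) \<Rightarrow> 'x::complex_vector \<otimes> 'h::{cstar_algebra, hopf_structure}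
     \<Rightarrow> 'x \<otimes> 'h \<Rightarrow> 'a::cstar_algebra \<otimes> 'h" where
  "crossed_lip lip \<xi> s t =
    tlift (\<lambda>x h. tlift (\<lambda>y l.
      tlift (\<lambda>h1 h2. tlift (\<lambda>l1 l2.
        lip x (induced_action \<xi> (star (antipode (h1 * star l1))) y) \<otimes> (h2 * star l2))
      (comult l)) (comult h)) t) s"

definition crossed_rip ::
    "('x \<Rightarrow> 'x \<Rightarrow> 'b) \<Rightarrow> ('b \<Rightarrow> 'b \<otimes> 'h dual) \<Rightarrow> 'x::complex_vector \<otimes> 'h::{cstar_algebra, hopf_structure}
     \<Rightarrow> 'x \<otimes> 'h \<Rightarrow> 'b::cstar_algebra \<otimes> 'h" where
  "crossed_rip rip \<sigma> s t =
    tlift (\<lambda>x h. tlift (\<lambda>y l.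
      tlift (\<lambda>h1 h2. induced_action \<sigma> (star h1) (rip x y) \<otimes> (star h2 * l)) (comult h)) t) s"

definition crossed_embed :: "'v::complex_vector \<Rightarrow> 'v \<otimes> 'h::cstar_algebra" where
  "crossed_embed v = v \<otimes> 1"

text \<open>The linear map \<open>v \<rtimes> h \<mapsto> \<tau>(h) v\<close>, which is \<open>E\<^sub>1\<^sup>\<rho>\<close>, \<open>E\<^sub>1\<^sup>\<sigma>\<close> or \<open>E\<^sub>1\<^sup>\<lambda>\<close> according to the type of \<open>v\<close>.\<close>

definition E1 :: "('h::cstar_algebra \<Rightarrow> complex) \<Rightarrow> 'v::complex_vector \<otimes> 'h \<Rightarrow> 'v" where
  "E1 \<tau> = tlift (\<lambda>v h. \<tau> h *\<^sub>C v)"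

lemma E1_tprod:
  fixes v :: "'v::complex_vector" and h :: "'h::cstar_algebra"
  assumes "clinear \<tau>"
  shows "E1 \<tau> (v \<otimes> h) = \<tau> h *\<^sub>C v" and "clinear (E1 \<tau> :: 'v \<otimes> 'h \<Rightarrow> 'v)"
proof -
  have "clinear (\<lambda>v :: 'v. \<tau> h *\<^sub>C v)" and "clinear (\<lambda>h. \<tau> h *\<^sub>C v)" for h and v :: 'v
    using assms by (simp_all add: clinear_iff scaleC_add_right scaleC_add_left scaleC_scaleC
      scaleC_complex_apply mult.commute)
  note * = clinear_tlift[of "\<lambda>(v :: 'v) h. \<tau> h *\<^sub>C v", OF this]
  show "clinear (E1 \<tau> :: 'v \<otimes> 'h \<Rightarrow> 'v)"
    unfolding E1_def by (rule *)
  show "E1 \<tau> (v \<otimes> h) = \<tau> h *\<^sub>C v"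
    unfolding E1_def by (rule tlift_tprod[OF *(1)])
qed


section \<open>Conditional expectations\<close>

text \<open>The inclusions \<open>A \<subseteq> C\<close>, \<open>B \<subseteq> D\<close>, \<open>X \<subseteq> Y\<close> are explicit embeddings \<open>\<iota>\<close>.\<close>

locale conditional_expectation =
  fixes mul :: "'c::complex_vector \<Rightarrow> 'c \<Rightarrow> 'c" and st :: "'c \<Rightarrow> 'c"
    and \<iota> :: "'a::cstar_algebra \<Rightarrow> 'c"
    and E :: "'c \<Rightarrow> 'a"
  assumes E_linear: "clinear E"
    and E_embed: "E (\<iota> a) = a"
    and E_left: "E (mul (\<iota> a) c) = a * E c"
    and E_right: "E (mul c (\<iota> a)) = E c * a"
    and E_positive: "positive_in mul st c \<Longrightarrow> positive (E c)"

locale bimodule_conditional_expectation =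
  A: conditional_expectation mulC starC \<iota>A EA + B: conditional_expectation mulD starD \<iota>B EB
  for mulC :: "'c::complex_vector \<Rightarrow> 'c \<Rightarrow> 'c" and starC and \<iota>A :: "'a::cstar_algebra \<Rightarrow> 'c" and EA
    and mulD :: "'d::complex_vector \<Rightarrow> 'd \<Rightarrow> 'd" and starD and \<iota>B :: "'b::cstar_algebra \<Rightarrow> 'd" and EB +
  fixes lactY :: "'c \<Rightarrow> 'y::complex_vector \<Rightarrow> 'y" and ractY :: "'y \<Rightarrow> 'd \<Rightarrow> 'y"
    and lipY :: "'y \<Rightarrow> 'y \<Rightarrow> 'c" and ripY :: "'y \<Rightarrow> 'y \<Rightarrow> 'd"
    and \<iota>X :: "'x::complex_vector \<Rightarrow> 'y"
    and EY :: "'y \<Rightarrow> 'x"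
  assumes EY_linear: "clinear EY"
    and EY_onto: "surj EY"
    and EY_lact: "\<iota>X (EY (lactY c (\<iota>X x))) = lactY (\<iota>A (EA c)) (\<iota>X x)"
    and EY_left: "\<iota>X (EY (lactY (\<iota>A a) y)) = lactY (\<iota>A a) (\<iota>X (EY y))"
    and EY_lip: "\<iota>A (EA (lipY y (\<iota>X x))) = lipY (\<iota>X (EY y)) (\<iota>X x)"
    and EY_ract: "\<iota>X (EY (ractY (\<iota>X x) d)) = ractY (\<iota>X x) (\<iota>B (EB d))"
    and EY_right: "\<iota>X (EY (ractY y (\<iota>B b))) = ractY (\<iota>X (EY y)) (\<iota>B b)"
    and EY_rip: "\<iota>B (EB (ripY y (\<iota>X x))) = ripY (\<iota>X (EY y)) (\<iota>X x)"

end

theory Submission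
  imports Defs
begin

text \<open>Write \<open>E\<close> for any of the maps \<open>v \<rtimes> h \<mapsto> \<tau>(h) v\<close>.

  All identities between \<open>E\<close>, the actions and the inner products are consequences of the invariance
  \<open>h\<^sub>1 \<tau>(h\<^sub>2) = \<tau>(h) 1\<close>. Once \<open>\<Delta>(1) = 1 \<otimes> 1\<close> is used, each expression that still contains a Sweedler sum has the form
  \<open>g(h\<^sub>1) \<tau>(h\<^sub>2)\<close> with \<open>g\<close> linear, so it equals \<open>\<tau>(h) g(1)\<close> (\<open>E1_sweedler\<close>), and \<open>g(1)\<close> is known because
  \<open>1 \<in> H\<close> acts trivially and is fixed by the antipode and the involution. For instance
  \<open>(v \<rtimes> h) \<cdot> (w \<rtimes> 1) = v \<cdot> [h\<^sub>1 \<cdot> w] \<rtimes> h\<^sub>2\<close> is sent to \<open>\<tau>(h) v \<cdot> w\<close>. The product of \<open>A \<rtimes> H\<close> and the two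
  actions on \<open>X \<rtimes> H\<close> are instances of one operation, so two lemmas, \<open>E1_crossed_mult_left\<close> and
  \<open>E1_crossed_mult_right\<close>, cover every module property. The right inner product also needs
  \<open>\<tau>(h\<^sup>*) = cnj (\<tau>(h))\<close>, which follows from positivity of \<open>\<tau>\<close> by polarization.

  The substantial point is that \<open>E\<close> maps positive elements of \<open>A \<rtimes> H\<close> to positive elements of \<open>A\<close>.
  With the factors in the order \<open>c = \<Sum>\<^sub>i (1 \<rtimes> h\<^sub>i)(b\<^sub>i \<rtimes> 1)\<close>, one gets
  \<open>c\<^sup>* c = \<Sum>\<^sub>i\<^sub>j (b\<^sub>i\<^sup>* \<rtimes> h\<^sub>i\<^sup>* h\<^sub>j)(b\<^sub>j \<rtimes> 1)\<close> and hence \<open>E(c\<^sup>* c) = \<Sum>\<^sub>i\<^sub>j \<tau>(h\<^sub>i\<^sup>* h\<^sub>j) b\<^sub>i\<^sup>* b\<^sub>j\<close>. The scalar Gram matrix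
  \<open>\<tau>(h\<^sub>i\<^sup>* h\<^sub>j)\<close> is positive semidefinite, and Gram-Schmidt turns the double sum into a sum of squares
  (\<open>positive_gram\<close>). That every \<open>c\<close> can be written in this order (\<open>factored_span\<close>) rests on
  \<open>h\<^sub>2 S(h\<^sub>1\<^sup>*)\<^sup>* = \<epsilon>(h) 1\<close>, which is the antipode axiom for \<open>h\<^sup>*\<close>.\<close>

section \<open>Semilinear maps and sums over tensors\<close>

text \<open>With \<open>\<theta>\<close> the identity these are the linear maps, with \<open>\<theta> = cnj\<close> the conjugate linear ones. Products are
  of the first kind, involutions of the second, and inner products mix both, so a common notion saves
  proving the rules for tensors twice.\<close>

definition semilin :: "(complex \<Rightarrow> complex) \<Rightarrow> ('v::complex_vector \<Rightarrow> 'w::complex_vector) \<Rightarrow> bool" where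
  "semilin \<theta> f \<longleftrightarrow> (\<forall>x y. f (x + y) = f x + f y) \<and> (\<forall>c x. f (c *\<^sub>C x) = \<theta> c *\<^sub>C f x)"

definition bisemilin ::
    "(complex \<Rightarrow> complex) \<Rightarrow> ('u::complex_vector \<Rightarrow> 'v::complex_vector \<Rightarrow> 'w::complex_vector) \<Rightarrow> bool" where
  "bisemilin \<theta> f \<longleftrightarrow> (\<forall>b. semilin \<theta> (\<lambda>a. f a b)) \<and> (\<forall>a. semilin \<theta> (f a))"

lemma clinear_semilin: "clinear f \<longleftrightarrow> semilin (\<lambda>c. c) f"
  by (simp add: clinear_iff semilin_def)

lemma semilin_add: "semilin \<theta> f \<Longrightarrow> f (x + y) = f x + f y"
  and semilin_scale: "semilin \<theta> f \<Longrightarrow> f (c *\<^sub>C x) = \<theta> c *\<^sub>C f x"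
  by (simp_all add: semilin_def)

lemma semilin_id: "semilin (\<lambda>c. c) (\<lambda>x. x)"
  by (simp add: semilin_def)

lemma semilin_zero: "semilin \<theta> f \<Longrightarrow> f 0 = 0"
  by (metis add_cancel_right_left semilin_add)

lemma semilin_sum: "semilin \<theta> f \<Longrightarrow> f (\<Sum>i\<in>I. g i) = (\<Sum>i\<in>I. f (g i))"
  by (induction I rule: infinite_finite_induct) (simp_all add: semilin_zero semilin_add)

lemma bisemilinI:
  assumes "\<And>b. semilin \<theta> (\<lambda>a. f a b)" and "\<And>a. semilin \<theta> (f a)"
  shows "bisemilin \<theta> f"
  using assms by (simp add: bisemilin_def)

lemma semilin_compose: "clinear g \<Longrightarrow> semilin \<theta> f \<Longrightarrow> semilin \<theta> (\<lambda>x. g (f x))"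
  and semilin_compose_clinear: "semilin \<theta> g \<Longrightarrow> clinear f \<Longrightarrow> semilin \<theta> (\<lambda>x. g (f x))"
  by (simp_all add: semilin_def clinear_iff)

lemma semilin_tprod_left: "semilin \<theta> f \<Longrightarrow> semilin \<theta> (\<lambda>x. f x \<otimes> b)"
  and semilin_tprod_right: "semilin \<theta> f \<Longrightarrow> semilin \<theta> (\<lambda>x. a \<otimes> f x)"
  by (simp_all add: semilin_def tprod_add_left tprod_add_right tprod_scaleC_left tprod_scaleC_right)

lemma bisemilin_balanced:
  assumes "bisemilin \<theta> f"
  shows "balanced f"
proof -
  have "f 0 b = 0" for b
    using assms semilin_zero[of \<theta> "\<lambda>a. f a b"] by (simp add: bisemilin_def)
  then show ?thesis
    using assms by (simp add: bisemilin_def balanced_def semilin_def)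
qed

text \<open>As \<open>tlift f t\<close> is by definition a finite sum of values of \<open>f\<close>, additive maps commute with it and
  two such sums may be interchanged, whether or not the summands are bilinear.\<close>

lemma tlift_push:
  fixes g :: "'v::ab_group_add \<Rightarrow> 'w::ab_group_add"
  assumes "\<And>x y. g (x + y) = g x + g y"
  shows "g (tlift f t) = tlift (\<lambda>a b. g (f a b)) t"
proof -
  have "g 0 = 0" using assms[of 0 0] by simp
  then have "g (\<Sum>(a, b)\<in>#M. f a b) = (\<Sum>(a, b)\<in>#M. g (f a b))" for M
    by (induction M) (auto simp: assms)
  then show ?thesis by (simp add: tlift_def)
qed

lemma tlift_swap: "tlift (\<lambda>a b. tlift (f a b) t) s = tlift (\<lambda>c d. tlift (\<lambda>a b. f a b c d) s) t"
  unfolding tlift_def case_prod_unfold by (rule sum_mset.swap)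

lemma tlift_add_fun: "tlift (\<lambda>a b. f a b + g a b) t = tlift f t + tlift g t"
  unfolding tlift_def case_prod_unfold by (rule sum_mset.distrib)

lemma tlift_scaleC_fun: "tlift (\<lambda>a b. c *\<^sub>C f a b) t = c *\<^sub>C tlift f t"
  by (rule tlift_push[symmetric]) (rule scaleC_add_right)

text \<open>A lifted map is evaluated as an honest finite sum, which is what allows an element of a crossed product
  to be written with finitely many coefficients \<open>b\<^sub>i\<close> and \<open>h\<^sub>i\<close>.\<close>

lemma tlift_as_sum:
  obtains n :: nat and a b where "tlift f t = (\<Sum>i<n. f (a i) (b i))"
proof -
  obtain ps where ps: "mset ps = rep_tensor t" using ex_mset by blast
  have "tlift f t = (\<Sum>i<length ps. f (fst (ps ! i)) (snd (ps ! i)))"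
    unfolding tlift_def ps[symmetric] case_prod_unfold
    by (simp add: sum_mset_sum_list sum_list_sum_nth atLeast0LessThan flip: mset_map)
  then show thesis by (rule that)
qed

lemma semilin_tlift_fun:
  assumes "\<And>a b. semilin \<theta> (\<lambda>v. f v a b)"
  shows "semilin \<theta> (\<lambda>v. tlift (f v) t)"
proof -
  have "f (x + y) = (\<lambda>a b. f x a b + f y a b)" and "f (c *\<^sub>C x) = (\<lambda>a b. \<theta> c *\<^sub>C f x a b)" for x y c
    using assms by (simp_all add: semilin_def fun_eq_iff)
  then show ?thesis
    by (simp add: semilin_def tlift_add_fun tlift_scaleC_fun)
qed

lemma semilin_tlift:
  assumes "bisemilin \<theta> f"
  shows "semilin \<theta> (tlift f)"
  using assms bisemilin_balanced[OF assms]
  by (auto simp: semilin_def bisemilin_def tlift_add intro: tlift_scaleC)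

lemma semilin_tlift_arg:
  assumes "clinear k" and "bisemilin \<theta> f"
  shows "semilin \<theta> (\<lambda>x. tlift f (k x))"
  by (rule semilin_compose_clinear[OF semilin_tlift[OF assms(2)] assms(1)])

text \<open>Only \<open>f\<close> has to respect the tensor relations. The maps \<open>g\<close> and \<open>k\<close> may be arbitrary, because \<open>tmap g k t\<close>
  is a sum over the same chosen representation of \<open>t\<close> as the right-hand side.\<close>

lemma tlift_tmap: "bisemilin \<theta> f \<Longrightarrow> tlift f (tmap g k t) = tlift (\<lambda>a b. f (g a) (k b)) t"
  unfolding tmap_def
  by (simp add: tlift_push[where g = "tlift f"] tlift_add tlift_tprod bisemilin_balanced)

lemma tlift_tassoc: "bisemilin \<theta> f \<Longrightarrow>
    tlift f (tassoc s) = tlift (\<lambda>t c. tlift (\<lambda>a b. f a (b \<otimes> c)) t) s"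
  unfolding tassoc_def
  by (simp add: tlift_push[where g = "tlift f"] tlift_add tlift_tprod bisemilin_balanced)

lemma tlift_times: "bisemilin \<theta> f \<Longrightarrow>
    tlift f (s * t) = tlift (\<lambda>a b. tlift (\<lambda>c d. f (a * c) (b * d)) t) s"
  unfolding times_tensor_def tmap2_def
  by (simp add: tlift_push[where g = "tlift f"] tlift_add tlift_tprod bisemilin_balanced)

lemma clinear_mult_left: "clinear (\<lambda>a. a * b)" and clinear_mult_right: "clinear ((*) a)"
  for a b :: "'a::star_algebra"
  by (simp_all add: clinear_iff distrib_left distrib_right scaleC_mult_left scaleC_mult_right)

lemma semilin_star: "semilin cnj (star :: 'a::star_algebra \<Rightarrow> 'a)"
  by (simp add: semilin_def star_add star_scaleC)

lemma star_one: "star 1 = (1 :: 'a::star_algebra)"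
  by (metis mult_1_left mult_1_right star_mult star_star)


section \<open>The induced action\<close>

lemma clinear_rslice: "clinear \<phi> \<Longrightarrow> clinear (rslice \<phi> :: 'v::complex_vector \<otimes> 'w::complex_vector \<Rightarrow> 'v)"
  unfolding rslice_def
  by (intro clinear_tlift) (auto simp: clinear_iff scaleC_add_left scaleC_add_right scaleC_scaleC
      scaleC_complex_apply mult.commute)

lemma clinear_eval: "clinear (\<lambda>\<phi>. dual_apply \<phi> h)"
  by (simp add: clinear_iff plus_dual.rep_eq scaleC_dual.rep_eq scaleC_complex_apply)

lemma clinear_induced_action:
  assumes "clinear \<kappa>"
  shows "clinear (induced_action \<kappa> h)"
  unfolding induced_action_def clinear_semilin
  by (rule semilin_compose[OF clinear_rslice[OF clinear_eval] assms[unfolded clinear_semilin]])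

lemma clinear_induced_action_left:
  fixes \<kappa> :: "'v::complex_vector \<Rightarrow> 'v \<otimes> 'h::complex_vector dual"
  shows "clinear (\<lambda>h. induced_action \<kappa> h v)"
proof -
  have "semilin (\<lambda>c. c) (\<lambda>h. dual_apply \<phi> h *\<^sub>C w)" for \<phi> :: "'h dual" and w :: 'v
    using clinear_dual_apply[of \<phi>]
    by (simp add: clinear_iff semilin_def scaleC_complex_apply scaleC_add_left scaleC_scaleC)
  then show ?thesis
    unfolding induced_action_def rslice_def clinear_semilin by (rule semilin_tlift_fun)
qed

lemma induced_action_one: "counital \<kappa> \<Longrightarrow> induced_action \<kappa> 1 v = v"
  unfolding counital_def induced_action_def dual_counit_def by simp

context cstar_hopf_algebra
begin

text \<open>Coassociativity of \<open>\<kappa>\<close>, evaluated against \<open>h\<close> and \<open>k\<close> in the two dual factors: \<open>\<kappa>\<close> applied twice gives the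
  iterated action, and \<open>\<Delta>\<^sup>0(\<phi>)\<close> evaluated at \<open>h \<otimes> k\<close> is \<open>\<phi>(h k)\<close>.\<close>

lemma induced_action_mult:
  fixes \<kappa> :: "'v::complex_vector \<Rightarrow> 'v \<otimes> 'h dual"
  assumes lin: "clinear \<kappa>" and co: "coassociative \<kappa>"
  shows "induced_action \<kappa> h (induced_action \<kappa> k v) = induced_action \<kappa> (h * k :: 'h) v"
proof -
  let ?F = "\<lambda>(w :: 'v) t. dual_pairing t h k *\<^sub>C w"
  have F: "bisemilin (\<lambda>c. c) ?F"
    using dual_pairing_linear[of h k]
    by (intro bisemilinI) (simp_all add: semilin_def clinear_iff scaleC_complex_apply
        scaleC_add_left scaleC_add_right scaleC_scaleC mult.commute)
  have pair: "dual_pairing (\<psi> \<otimes> \<phi>) h k = dual_apply \<psi> h * dual_apply \<phi> k" for \<psi> \<phi>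
    by (simp add: dual_pairing_def tlift_tprod dual_pairing_balanced)
  let ?G = "\<lambda>t \<phi>. tlift (\<lambda>w \<psi>. ?F w (\<psi> \<otimes> \<phi>)) t"
  have G: "?G t \<phi> = dual_apply \<phi> k *\<^sub>C rslice (\<lambda>\<phi>. dual_apply \<phi> h) t" for t \<phi>
    by (simp add: pair rslice_def mult.commute scaleC_scaleC flip: tlift_scaleC_fun)
  have "bisemilin (\<lambda>c. c) ?G"
    unfolding G using clinear_rslice[OF clinear_eval[of h], where 'v = 'v]
    by (intro bisemilinI) (simp_all add: semilin_def clinear_iff plus_dual.rep_eq scaleC_dual.rep_eq
        scaleC_add_left scaleC_add_right scaleC_scaleC mult.commute)
  then have "tlift ?F (tassoc (tmap \<kappa> id (\<kappa> v))) = tlift (\<lambda>w \<phi>. ?G (\<kappa> w) \<phi>) (\<kappa> v)"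
    by (simp add: tlift_tassoc[OF F] tlift_tmap)
  also have "\<dots> = induced_action \<kappa> h (induced_action \<kappa> k v)"
    unfolding G induced_action_def[of \<kappa> k] rslice_def[of "\<lambda>\<phi>. dual_apply \<phi> k"]
    using clinear_induced_action[OF lin, of h]
    by (subst tlift_push[where g = "induced_action \<kappa> h"])
      (simp_all add: clinear_iff induced_action_def[of \<kappa> h])
  finally have "tlift ?F (tassoc (tmap \<kappa> id (\<kappa> v))) = induced_action \<kappa> h (induced_action \<kappa> k v)" .
  moreover have "tlift ?F (tmap id dual_comult (\<kappa> v)) = induced_action \<kappa> (h * k) v"
    by (simp add: tlift_tmap[OF F] dual_pairing_dual_comult induced_action_def rslice_def)
  ultimately show ?thesis
    using co by (simp add: coassociative_def)
qed

text \<open>The involution of the dual is \<open>\<phi>\<^sup>*(h) = cnj (\<phi>(S(h)\<^sup>*))\<close>, and \<open>h \<mapsto> S(h)\<^sup>*\<close> is its own inverse.\<close>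

lemma star_induced_action:
  fixes \<rho> :: "'a::cstar_algebra \<Rightarrow> 'a \<otimes> 'h dual"
  assumes "\<And>a. \<rho> (star a) = star (\<rho> a)"
  shows "star (induced_action \<rho> h a) = induced_action \<rho> (star (antipode h)) (star a)"
proof -
  let ?k = "star (antipode h)"
  have k: "star (antipode ?k) = h"
    using antipode_star[of "star h"] by (simp add: star_star)
  have bil: "bisemilin (\<lambda>c. c) (\<lambda>(a :: 'a) \<phi>. dual_apply \<phi> ?k *\<^sub>C a)"
    by (intro bisemilinI) (simp_all add: semilin_def plus_dual.rep_eq scaleC_dual.rep_eq
        scaleC_add_left scaleC_add_right scaleC_scaleC mult.commute)
  have "induced_action \<rho> ?k (star a) = tlift (\<lambda>b \<phi>. dual_apply (star \<phi>) ?k *\<^sub>C star b) (\<rho> a)"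
    by (simp add: induced_action_def rslice_def assms star_tensor_def tlift_tmap[OF bil])
  also have "\<dots> = star (tlift (\<lambda>b \<phi>. dual_apply \<phi> h *\<^sub>C b) (\<rho> a))"
    by (subst tlift_push[where g = star]) (simp_all add: star_add star_scaleC dual_apply_star k)
  finally show ?thesis
    by (simp add: induced_action_def rslice_def)
qed

section \<open>Sweedler sums\<close>

text \<open>A sum over \<open>h\<^sub>1 \<otimes> h\<^sub>2 \<otimes> h\<^sub>3\<close> may be formed by splitting either factor of \<open>\<Delta>(h)\<close>, provided the summand is
  semilinear in each argument.\<close>

lemma tlift_comult_coassoc:
  fixes f :: "'h \<Rightarrow> 'h \<Rightarrow> 'h \<Rightarrow> 'w::complex_vector"
  assumes "\<And>y z. semilin \<theta> (\<lambda>x. f x y z)" and "\<And>x z. semilin \<theta> (\<lambda>y. f x y z)"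
    and "\<And>x y. semilin \<theta> (f x y)"
  shows "tlift (\<lambda>x y. tlift (f x) (comult y)) (comult h) =
    tlift (\<lambda>x z. tlift (\<lambda>x1 x2. f x1 x2 z) (comult x)) (comult h)"
proof -
  have b: "bisemilin \<theta> (f x)" "bisemilin \<theta> (\<lambda>x y. f x y z)" for x z
    using assms by (auto intro: bisemilinI)
  let ?F = "\<lambda>x. tlift (f x)" and ?G = "\<lambda>t z. tlift (\<lambda>x y. f x y z) t"
  have F: "bisemilin \<theta> ?F" and G: "bisemilin \<theta> ?G"
    by (intro bisemilinI semilin_tlift_fun semilin_tlift assms b)+
  have "tlift ?F (tassoc (tmap comult id (comult h))) = tlift ?F (tmap id comult (comult h))"
    by (simp add: comult_coassoc)
  then show ?thesis
    by (simp add: tlift_tassoc[OF F] tlift_tprod bisemilin_balanced[OF b(1)]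
        tlift_tmap[OF F] tlift_tmap[OF G])
qed

lemma tlift_comult_mult:
  "bisemilin \<theta> f \<Longrightarrow> tlift f (comult (h * l :: 'h)) =
    tlift (\<lambda>h1 h2. tlift (\<lambda>l1 l2. f (h1 * l1) (h2 * l2)) (comult l)) (comult h)"
  by (simp add: comult_mult tlift_times)

lemma tlift_comult_star:
  "bisemilin \<theta> f \<Longrightarrow>
    tlift f (comult (star h :: 'h)) = tlift (\<lambda>h1 h2. f (star h1) (star h2)) (comult h)"
  by (simp add: comult_star star_tensor_def tlift_tmap)

lemma tlift_comult_one: "bisemilin \<theta> f \<Longrightarrow> tlift f (comult (1 :: 'h)) = f 1 1"
  by (simp add: comult_one one_tensor_def tlift_tprod bisemilin_balanced)

lemma tlift_counit:
  assumes "semilin \<theta> g"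
  shows "tlift (\<lambda>x y. g (counit x *\<^sub>C y)) (comult (h :: 'h)) = g h"
  using counit_left[of h] tlift_push[where g = g, OF semilin_add[OF assms]]
  by (metis lslice_def)

lemma antipode_one: "antipode (1 :: 'h) = 1"
proof -
  have "bisemilin (\<lambda>c. c) (\<lambda>x y :: 'h. antipode x * y)"
    using antipode_linear by (intro bisemilinI) (simp_all add: semilin_def clinear_iff
        distrib_left distrib_right scaleC_mult_left scaleC_mult_right)
  from tlift_comult_one[OF this] show ?thesis
    using antipode_left[of 1] by (simp add: counit_one scaleC_one)
qed

text \<open>The map \<open>h \<mapsto> S(h\<^sup>*)\<^sup>*\<close> is the inverse of the antipode, and it satisfies the antipode axiom with the
  factors exchanged. The identity is the adjoint of the antipode axiom for \<open>h\<^sup>*\<close>.\<close>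

lemma antipode_inverse:
  "tlift (\<lambda>x y. y * star (antipode (star x))) (comult (h :: 'h)) = counit h *\<^sub>C 1"
proof -
  have b: "bisemilin (\<lambda>c. c) (\<lambda>x y :: 'h. antipode x * y)"
    using antipode_linear by (intro bisemilinI) (simp_all add: semilin_def clinear_iff
        distrib_left distrib_right scaleC_mult_left scaleC_mult_right)
  have "tlift (\<lambda>x y. y * star (antipode (star x))) (comult h) =
      star (tlift (\<lambda>x y. antipode x * y) (comult (star h)))"
    unfolding tlift_comult_star[OF b]
    by (subst tlift_push[where g = star]) (simp_all add: star_add star_mult star_star)
  then show ?thesis
    by (simp add: antipode_left counit_star star_scaleC star_one)
qed

end

section \<open>The Haar trace and the maps it induces\<close>

lemma E1_clinear: "haar_trace \<tau> \<Longrightarrow> clinear (E1 \<tau> :: 'v::complex_vector \<otimes> 'h::{cstar_algebra,hopf_structure} \<Rightarrow> 'v)"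
  and E1_pure: "haar_trace \<tau> \<Longrightarrow> E1 \<tau> (v \<otimes> h) = \<tau> h *\<^sub>C v"
  by (auto simp: haar_trace_def E1_tprod)

lemma E1_embed: "haar_trace \<tau> \<Longrightarrow> E1 \<tau> (crossed_embed v) = v"
  by (simp add: E1_pure crossed_embed_def scaleC_one haar_trace_def)

text \<open>Invariance of the Haar trace in the form in which every module property uses it.\<close>

lemma E1_sweedler:
  assumes haar: "haar_trace \<tau>" and g: "clinear g"
  shows "E1 \<tau> (tlift (\<lambda>h1 h2. g h1 \<otimes> h2) (comult h)) = \<tau> h *\<^sub>C g 1"
proof -
  have "E1 \<tau> (tlift (\<lambda>h1 h2. g h1 \<otimes> h2) (comult h)) = tlift (\<lambda>h1 h2. g (\<tau> h2 *\<^sub>C h1)) (comult h)"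
    using E1_clinear[OF haar, where 'v = 'b] g
    by (subst tlift_push[where g = "E1 \<tau>"]) (simp_all add: clinear_iff E1_pure[OF haar])
  also have "\<dots> = g (rslice \<tau> (comult h))"
    using g unfolding rslice_def by (subst tlift_push[where g = g]) (simp_all add: clinear_iff)
  also have "\<dots> = \<tau> h *\<^sub>C g 1"
    using haar g by (simp add: haar_trace_def clinear_iff)
  finally show ?thesis .
qed

text \<open>Polarization: \<open>\<tau>(x) + \<tau>(x\<^sup>*)\<close> is real, as it is a combination of values of \<open>\<tau>\<close> at \<open>(1 + x)\<^sup>*(1 + x)\<close>,
  \<open>x\<^sup>* x\<close> and \<open>1\<close>. The cases \<open>x = h\<close> and \<open>x = i h\<close> give the imaginary and the real part.\<close>

lemma haar_star:
  fixes \<tau> :: "'h::{cstar_algebra, hopf_structure} \<Rightarrow> complex"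
  assumes "haar_trace \<tau>"
  shows "\<tau> (star h) = cnj (\<tau> h)"
proof -
  have lin: "\<tau> (x + y) = \<tau> x + \<tau> y" "\<tau> (c *\<^sub>C x) = c * \<tau> x" for x y c
    using assms by (simp_all add: haar_trace_def clinear_iff scaleC_complex_apply)
  have pos: "Im (\<tau> (star x * x)) = 0" for x
    using assms by (auto simp: haar_trace_def complex_nonneg_Reals_iff)
  have *: "Im (\<tau> x + \<tau> (star x)) = 0" for x
    using pos[of "1 + x"] pos[of x] pos[of 1]
    by (simp add: star_add star_one distrib_left distrib_right lin)
  have minus: "\<tau> (- x) = - \<tau> x" for x
    using lin(2)[of "- 1" x] by (simp add: scaleC_one)
  show ?thesis
    using *[of h] *[of "\<i> *\<^sub>C h"] by (simp add: star_scaleC lin minus complex_eq_iff)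
qed

section \<open>Products and actions in crossed products\<close>

context cstar_hopf_algebra
begin

context
  fixes p :: "'u::complex_vector \<Rightarrow> 'v::complex_vector \<Rightarrow> 'w::complex_vector"
    and \<kappa> :: "'v \<Rightarrow> 'v \<otimes> 'h dual"
  assumes p1: "\<And>w. clinear (\<lambda>v. p v w)" and p2: "\<And>v. clinear (p v)" and \<kappa>: "clinear \<kappa>"
begin

lemma clinear_p_action:
  "clinear (\<lambda>h. p v (induced_action \<kappa> h w))" "clinear (\<lambda>v. p v (induced_action \<kappa> h w))"
  "clinear (\<lambda>w. p v (induced_action \<kappa> h w))"
  using p1 p2 clinear_induced_action[OF \<kappa>] clinear_induced_action_left[of \<kappa>] unfolding clinear_iff
  by auto

lemma crossed_mult_summand_bilinear:
  "bisemilin (\<lambda>c. c) (\<lambda>h1 h2. p v (induced_action \<kappa> h1 w) \<otimes> (h2 * l :: 'h))"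
  by (intro bisemilinI semilin_tprod_left semilin_tprod_right; fold clinear_semilin)
    (rule clinear_p_action clinear_mult_left)+

lemma crossed_mult_bilinear_inner: "bisemilin (\<lambda>c. c) (\<lambda>w l.
      tlift (\<lambda>h1 h2. p v (induced_action \<kappa> h1 w) \<otimes> (h2 * l :: 'h)) (comult h))"
  by (intro bisemilinI semilin_tlift_fun semilin_tprod_left semilin_tprod_right; fold clinear_semilin)
    (rule clinear_p_action clinear_mult_right)+

lemma crossed_mult_bilinear_outer: "bisemilin (\<lambda>c. c) (\<lambda>v h. tlift (\<lambda>w l.
      tlift (\<lambda>h1 h2. p v (induced_action \<kappa> h1 w) \<otimes> (h2 * l :: 'h)) (comult h)) t)"
proof (rule bisemilinI)
  have "semilin (\<lambda>c. c) (\<lambda>v. p v (induced_action \<kappa> h w) \<otimes> (l * m))" for h w and l m :: 'h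
    by (intro semilin_tprod_left; fold clinear_semilin) (rule clinear_p_action)
  then show "semilin (\<lambda>c. c) (\<lambda>v. tlift (\<lambda>w l.
      tlift (\<lambda>h1 h2. p v (induced_action \<kappa> h1 w) \<otimes> (h2 * l)) (comult h)) t)" for h :: 'h
    by (intro semilin_tlift_fun)
  show "semilin (\<lambda>c. c) (\<lambda>h. tlift (\<lambda>w l.
      tlift (\<lambda>h1 h2. p v (induced_action \<kappa> h1 w) \<otimes> (h2 * l :: 'h)) (comult h)) t)" for v
    by (intro semilin_tlift_fun semilin_tlift_arg comult_linear crossed_mult_summand_bilinear)
qed

lemma crossed_mult_semilin_left: "semilin (\<lambda>c. c) (\<lambda>s. crossed_mult p \<kappa> s t)"
  unfolding crossed_mult_def by (rule semilin_tlift[OF crossed_mult_bilinear_outer])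

lemma crossed_mult_semilin_right: "semilin (\<lambda>c. c) (crossed_mult p \<kappa> s)"
  unfolding crossed_mult_def
  by (intro semilin_tlift_fun semilin_tlift[OF crossed_mult_bilinear_inner])

lemma crossed_mult_tprod:
  "crossed_mult p \<kappa> (v \<otimes> h) (w \<otimes> l) =
    tlift (\<lambda>h1 h2. p v (induced_action \<kappa> h1 w) \<otimes> (h2 * l)) (comult h)"
  unfolding crossed_mult_def
  by (subst tlift_tprod[OF bisemilin_balanced[OF crossed_mult_bilinear_outer]],
      subst tlift_tprod[OF bisemilin_balanced[OF crossed_mult_bilinear_inner]]) (rule refl)

text \<open>Here \<open>\<Delta>(1) = 1 \<otimes> 1\<close> and \<open>1\<close> acts trivially, so no Sweedler sum remains.\<close>

lemma crossed_mult_embed_left: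
  assumes "counital \<kappa>"
  shows "crossed_mult p \<kappa> (crossed_embed v) (w \<otimes> l) = p v w \<otimes> l"
  by (simp add: crossed_embed_def crossed_mult_tprod tlift_comult_one[OF crossed_mult_summand_bilinear]
      induced_action_one[OF assms])

lemma crossed_mult_embed:
  assumes "counital \<kappa>"
  shows "crossed_mult p \<kappa> (crossed_embed v) (crossed_embed w) = crossed_embed (p v w)"
  using crossed_mult_embed_left[OF assms, of v w 1] by (simp add: crossed_embed_def)

lemma E1_crossed_mult_left:
  assumes counital: "counital \<kappa>" and haar: "haar_trace \<tau>"
  shows "E1 \<tau> (crossed_mult p \<kappa> (crossed_embed v) t) = p v (E1 \<tau> t)"
proof -
  note E1V = E1_clinear[OF haar, where 'v = 'v, unfolded clinear_semilin]
    and E1W = E1_clinear[OF haar, where 'v = 'w, unfolded clinear_semilin]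
    and m = crossed_mult_semilin_right and pv = p2[of v, unfolded clinear_semilin]
  show ?thesis
  proof (induction t rule: tensor_induct)
    case zero
    show ?case
      by (simp add: semilin_zero[OF m] semilin_zero[OF E1V] semilin_zero[OF E1W] semilin_zero[OF pv])
  next
    case (add w l t)
    then show ?case
      by (simp add: semilin_add[OF m] semilin_add[OF E1V] semilin_add[OF E1W] semilin_add[OF pv]
          semilin_scale[OF pv] crossed_mult_embed_left[OF counital] E1_pure[OF haar])
  qed
qed

text \<open>On pure tensors, \<open>(v \<rtimes> h)(w \<rtimes> 1) = p v (h\<^sub>1 \<cdot> w) \<rtimes> h\<^sub>2\<close>, and invariance replaces \<open>h\<^sub>1 \<tau>(h\<^sub>2)\<close> by \<open>\<tau>(h) 1\<close>.\<close>

lemma E1_crossed_mult_right: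
  assumes counital: "counital \<kappa>" and haar: "haar_trace \<tau>"
  shows "E1 \<tau> (crossed_mult p \<kappa> s (crossed_embed w)) = p (E1 \<tau> s) w"
proof -
  note E1U = E1_clinear[OF haar, where 'v = 'u, unfolded clinear_semilin]
    and E1W = E1_clinear[OF haar, where 'v = 'w, unfolded clinear_semilin]
    and m = crossed_mult_semilin_left and pw = p1[of w, unfolded clinear_semilin]
  show ?thesis
  proof (induction s rule: tensor_induct)
    case zero
    show ?case
      by (simp add: semilin_zero[OF m] semilin_zero[OF E1U] semilin_zero[OF E1W] semilin_zero[OF pw])
  next
    case (add v h s)
    have "E1 \<tau> (crossed_mult p \<kappa> (v \<otimes> h) (crossed_embed w)) = \<tau> h *\<^sub>C p v w"
      using E1_sweedler[OF haar clinear_p_action(1)]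
      by (simp add: crossed_embed_def crossed_mult_tprod induced_action_one[OF counital])
    with add show ?case
      by (simp add: semilin_add[OF m] semilin_add[OF E1U] semilin_add[OF E1W] semilin_add[OF pw]
          semilin_scale[OF pw] E1_pure[OF haar])
  qed
qed

end

end

section \<open>Gram sums are positive\<close>

lemma positive_add:
  assumes "positive x" and "positive y"
  shows "positive (x + y)"
proof -
  obtain xs ys where "x = (\<Sum>z\<leftarrow>xs. star z * z)" "y = (\<Sum>z\<leftarrow>ys. star z * z)"
    using assms by (auto simp: positive_in_def)
  then have "x + y = (\<Sum>z\<leftarrow>xs @ ys. star z * z)" by simp
  then show ?thesis unfolding positive_in_def by blast
qed

lemma positive_zero: "positive 0"
  unfolding positive_in_def by (rule exI[of _ "[]"]) simp

lemma positive_square: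
  assumes "r \<ge> 0"
  shows "positive (complex_of_real r *\<^sub>C (star y * y))"
proof -
  have "complex_of_real r *\<^sub>C (star y * y) =
      star (complex_of_real (sqrt r) *\<^sub>C y) * (complex_of_real (sqrt r) *\<^sub>C y)"
    using assms by (simp add: star_scaleC scaleC_mult_left scaleC_mult_right scaleC_scaleC
        flip: of_real_mult)
  then show ?thesis
    unfolding positive_in_def by (intro exI[of _ "[complex_of_real (sqrt r) *\<^sub>C y]"]) simp
qed

locale semi_inner =
  fixes g :: "'v::complex_vector \<Rightarrow> 'v \<Rightarrow> complex"
  assumes g_linear: "clinear (g x)"
    and g_hermitian: "g y x = cnj (g x y)"
    and g_nonneg: "g x x \<in> \<real>\<^sub>\<ge>\<^sub>0"
begin

lemma g_add_right: "g x (y + z) = g x y + g x z" and g_scale_right: "g x (c *\<^sub>C y) = c * g x y"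
  using g_linear by (simp_all add: clinear_iff scaleC_complex_apply)

lemma g_add_left: "g (y + z) x = g y x + g z x" and g_scale_left: "g (c *\<^sub>C y) x = cnj c * g y x"
  by (simp_all add: g_hermitian[of _ x] g_add_right g_scale_right)

text \<open>The degenerate case of the Cauchy-Schwarz inequality. If \<open>g x x = 0\<close> and \<open>g x y \<noteq> 0\<close>, then for
  \<open>v = y + t (g x y) x\<close> the value \<open>g v v\<close> is an affine function of the real number \<open>t\<close> that is not constant,
  so some \<open>t\<close> gives the value \<open>- 1\<close>.\<close>

lemma null_orthogonal:
  assumes "g x x = 0"
  shows "g x y = 0"
proof (rule ccontr)
  assume "g x y \<noteq> 0"
  define t where "t = - ((Re (g y y) + 1) / (2 * (cmod (g x y))\<^sup>2))"
  define z where "z = complex_of_real t * g x y"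
  have "g (y + z *\<^sub>C x) (y + z *\<^sub>C x) = g y y + (z * cnj (g x y) + cnj z * g x y)"
    using assms by (simp add: g_add_left g_add_right g_scale_left g_scale_right g_hermitian[of y x])
  also have "z * cnj (g x y) + cnj z * g x y = complex_of_real (2 * t * (cmod (g x y))\<^sup>2)"
    unfolding of_real_mult complex_norm_square by (simp add: z_def)
  also have "2 * t * (cmod (g x y))\<^sup>2 = - (Re (g y y) + 1)"
    using \<open>g x y \<noteq> 0\<close> by (simp add: t_def field_simps)
  finally have "Re (g (y + z *\<^sub>C x) (y + z *\<^sub>C x)) = - 1" by simp
  then show False
    using g_nonneg[of "y + z *\<^sub>C x"] by (simp add: complex_nonneg_Reals_iff)
qed

text \<open>Gram-Schmidt, one vector at a time. Splitting off the component of each \<open>h\<^sub>i\<close> along \<open>h\<^sub>k\<close>, with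
  \<open>h\<^sub>i = h\<^sub>i' + c\<^sub>i h\<^sub>k\<close>, collects all terms that involve \<open>h\<^sub>k\<close> into \<open>r y\<^sup>* y\<close> for \<open>r = g h\<^sub>k h\<^sub>k\<close> and
  \<open>y = b\<^sub>k + \<Sum>\<^sub>i c\<^sub>i b\<^sub>i\<close>. What is left is the same sum for the vectors \<open>h\<^sub>i'\<close> and one index fewer.\<close>

lemma positive_gram:
  fixes b :: "'i \<Rightarrow> 'a::star_algebra"
  assumes "finite I"
  shows "positive (\<Sum>i\<in>I. \<Sum>j\<in>I. g (h i) (h j) *\<^sub>C (star (b i) * b j))"
  using assms
proof (induction I arbitrary: h rule: finite_induct)
  case empty
  then show ?case by (simp add: positive_zero)
next
  case (insert k I)
  let ?P = "\<lambda>i j. star (b i) * b j"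
  define r where "r = Re (g (h k) (h k))"
  have r: "g (h k) (h k) = complex_of_real r" "r \<ge> 0"
    using g_nonneg[of "h k"] by (auto simp: r_def complex_nonneg_Reals_iff complex_eq_iff)
  \<comment> \<open>If \<open>r = 0\<close>, division by zero makes every \<open>c i\<close> vanish, and \<open>null_orthogonal\<close> makes \<open>gk\<close> below still hold.\<close>
  define c where "c i = g (h k) (h i) / r" for i
  define h' where "h' i = h i + (- c i) *\<^sub>C h k" for i
  define y where "y = b k + (\<Sum>i\<in>I. c i *\<^sub>C b i)"
  have gk: "g (h k) (h i) = r * c i" for i
    using null_orthogonal[of "h k" "h i"] by (cases "r = 0") (simp_all add: c_def r)
  then have gk': "g (h i) (h k) = r * cnj (c i)" for i
    by (subst g_hermitian) (simp)
  have split: "g (h i) (h j) = r * (cnj (c i) * c j) + g (h' i) (h' j)" for i j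
  proof -
    have "g (h' i) (h' j) = g (h i) (h j) - c j * g (h i) (h k) - cnj (c i) * g (h k) (h j)
        + cnj (c i) * c j * g (h k) (h k)"
      by (simp add: h'_def g_add_left g_add_right g_scale_left g_scale_right algebra_simps
          del: cvec.scale_minus_left)
    then show ?thesis
      by (simp only: gk[of j] gk'[of i] r(1)) (simp add: algebra_simps)
  qed
  have ck: "r * c k = r"
    using gk[of k] r(1) by simp
  have inner: "(\<Sum>i\<in>I. \<Sum>j\<in>I. g (h i) (h j) *\<^sub>C ?P i j) =
      (\<Sum>i\<in>I. \<Sum>j\<in>I. (r * (cnj (c i) * c j)) *\<^sub>C ?P i j) +
      (\<Sum>i\<in>I. \<Sum>j\<in>I. g (h' i) (h' j) *\<^sub>C ?P i j)"
    by (subst split) (simp add: scaleC_add_left sum.distrib)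
  have "(\<Sum>i\<in>insert k I. \<Sum>j\<in>insert k I. g (h i) (h j) *\<^sub>C ?P i j) =
      complex_of_real r *\<^sub>C ?P k k + (\<Sum>j\<in>I. (r * c j) *\<^sub>C ?P k j) +
      ((\<Sum>i\<in>I. (r * cnj (c i)) *\<^sub>C ?P i k) + (\<Sum>i\<in>I. \<Sum>j\<in>I. (r * (cnj (c i) * c j)) *\<^sub>C ?P i j)) +
      (\<Sum>i\<in>I. \<Sum>j\<in>I. g (h' i) (h' j) *\<^sub>C ?P i j)"
    using insert.hyps ck by (auto simp: gk gk' inner sum.distrib)
  also have "complex_of_real r *\<^sub>C ?P k k + (\<Sum>j\<in>I. (r * c j) *\<^sub>C ?P k j) +
      ((\<Sum>i\<in>I. (r * cnj (c i)) *\<^sub>C ?P i k) + (\<Sum>i\<in>I. \<Sum>j\<in>I. (r * (cnj (c i) * c j)) *\<^sub>C ?P i j)) =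
      complex_of_real r *\<^sub>C (star y * y)"
    by (simp add: y_def star_add semilin_sum[OF semilin_star] star_scaleC distrib_left distrib_right
        sum_product scaleC_mult_left scaleC_mult_right scaleC_scaleC scaleC_add_right
        sum_distrib_left sum_distrib_right cvec.scale_sum_right sum.distrib mult.assoc)
      (subst sum.swap, simp add: mult.commute)
  finally show ?case
    using positive_add[OF positive_square[OF r(2), of y] insert.IH[of h']] by simp
qed

end

lemma haar_semi_inner:
  fixes \<tau> :: "'h::{cstar_algebra, hopf_structure} \<Rightarrow> complex"
  assumes "haar_trace \<tau>"
  shows "semi_inner (\<lambda>h l. \<tau> (star h * l))"
proof (rule semi_inner.intro)
  show "clinear (\<lambda>l. \<tau> (star h * l))" for h
    using assms by (simp add: haar_trace_def clinear_iff distrib_left scaleC_mult_right)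
  show "\<tau> (star l * h) = cnj (\<tau> (star h * l))" for h l
    by (simp add: haar_star[OF assms, symmetric] star_mult star_star)
  show "\<tau> (star h * h) \<in> \<real>\<^sub>\<ge>\<^sub>0" for h
    using assms by (simp add: haar_trace_def)
qed

section \<open>Positivity of the expectation of a crossed product\<close>

context cstar_hopf_algebra
begin

context
  fixes \<rho> :: "'a::cstar_algebra \<Rightarrow> 'a \<otimes> 'h dual"
  assumes \<rho>: "coaction \<rho>"
begin

lemma \<rho>_linear: "clinear \<rho>" and \<rho>_star: "\<rho> (star a) = star (\<rho> a)"
  and \<rho>_coassoc: "coassociative \<rho>" and \<rho>_counital: "counital \<rho>"
  using \<rho> by (auto simp: coaction_def)

lemmas crossed_product_mult_tprod =
  crossed_mult_tprod[OF clinear_mult_left clinear_mult_right \<rho>_linear]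
lemmas crossed_product_mult_left = crossed_mult_semilin_left[OF clinear_mult_left clinear_mult_right \<rho>_linear]
  and crossed_product_mult_right = crossed_mult_semilin_right[OF clinear_mult_left clinear_mult_right \<rho>_linear]

text \<open>The element \<open>(1 \<rtimes> h)(b \<rtimes> 1)\<close>, with the coefficient on the right. Positivity of the expectation is visible
  in this order of the factors.\<close>

abbreviation factored :: "'a \<Rightarrow> 'h \<Rightarrow> 'a \<otimes> 'h" where
  "factored b h \<equiv> crossed_mult (*) \<rho> (1 \<otimes> h) (crossed_embed b)"

lemma factored_eq: "factored b h = tlift (\<lambda>h1 h2. induced_action \<rho> h1 b \<otimes> h2) (comult h)"
  by (simp add: crossed_embed_def crossed_product_mult_tprod)

lemma action_semilin: "semilin \<theta> f \<Longrightarrow> semilin \<theta> (\<lambda>x. induced_action \<rho> (f x) a)"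
  and action_semilin_arg: "semilin \<theta> k \<Longrightarrow> semilin \<theta> (\<lambda>x. induced_action \<rho> h (k x))"
  by (rule semilin_compose[OF clinear_induced_action_left]
      semilin_compose[OF clinear_induced_action[OF \<rho>_linear]]; assumption)+

lemma factored_bilinear: "bisemilin (\<lambda>c. c) factored"
  unfolding factored_eq
  by (intro bisemilinI semilin_tlift_fun semilin_tprod_left action_semilin_arg semilin_id semilin_tlift_arg
      comult_linear semilin_tprod_right action_semilin)

lemma crossed_star_bisemilin: "bisemilin cnj (\<lambda>a h.
    tlift (\<lambda>h1 h2. induced_action \<rho> (star h1) (star a) \<otimes> star h2) (comult h))"
  by (intro bisemilinI semilin_tlift_fun semilin_tprod_left action_semilin_arg semilin_star
      semilin_tlift_arg comult_linear semilin_tprod_right action_semilin)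

lemma crossed_star_semilin: "semilin cnj (crossed_star \<rho>)"
  unfolding crossed_star_def by (rule semilin_tlift[OF crossed_star_bisemilin])

lemma crossed_star_tprod: "crossed_star \<rho> (a \<otimes> h) =
    tlift (\<lambda>h1 h2. induced_action \<rho> (star h1) (star a) \<otimes> star h2) (comult h)"
  unfolding crossed_star_def by (rule tlift_tprod[OF bisemilin_balanced[OF crossed_star_bisemilin]])

text \<open>In the \<open>*\<close>-algebra \<open>A \<rtimes> H\<close> this is \<open>((1 \<rtimes> h)(a \<rtimes> 1))\<^sup>* = (a\<^sup>* \<rtimes> 1)(1 \<rtimes> h\<^sup>*)\<close>. The computation goes
  through the explicit involution: \<open>h\<^sub>2\<^sup>* \<cdot> (h\<^sub>1 \<cdot> a)\<^sup>* = (S(h\<^sub>1) h\<^sub>2)\<^sup>* \<cdot> a\<^sup>*\<close>, and the antipode axiom removes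
  \<open>S(h\<^sub>1) h\<^sub>2\<close>.\<close>

lemma crossed_star_factored: "crossed_star \<rho> (factored a h) = star a \<otimes> star h"
proof -
  let ?f = "\<lambda>x y z. induced_action \<rho> (star (antipode x * y)) (star a) \<otimes> (star z :: 'h)"
  have "crossed_star \<rho> (factored a h) =
      tlift (\<lambda>h1 h2. crossed_star \<rho> (induced_action \<rho> h1 a \<otimes> h2)) (comult h)"
    unfolding factored_eq by (rule tlift_push) (rule semilin_add[OF crossed_star_semilin])
  also have "\<dots> = tlift (\<lambda>x y. tlift (?f x) (comult y)) (comult h)"
    by (simp add: crossed_star_tprod star_induced_action[of \<rho>, OF \<rho>_star] star_mult
        induced_action_mult[OF \<rho>_linear \<rho>_coassoc])
  also have "\<dots> = tlift (\<lambda>x z. tlift (\<lambda>x1 x2. ?f x1 x2 z) (comult x)) (comult h)"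
  proof (rule tlift_comult_coassoc)
    show "semilin cnj (\<lambda>x. ?f x y z)" for y z
      using antipode_linear by (intro semilin_tprod_left action_semilin)
        (simp add: semilin_def clinear_iff star_add star_scaleC star_mult distrib_left scaleC_mult_right)
    show "semilin cnj (\<lambda>y. ?f x y z)" for x z
      by (intro semilin_tprod_left action_semilin)
        (simp add: semilin_def star_add star_scaleC star_mult distrib_right scaleC_mult_left)
    show "semilin cnj (?f x y)" for x y
      by (intro semilin_tprod_right semilin_star)
  qed
  also have "\<dots> = tlift (\<lambda>x z. star a \<otimes> star (counit x *\<^sub>C z)) (comult h)"
  proof -
    have lin: "semilin cnj (\<lambda>u. induced_action \<rho> (star u) (star a) \<otimes> star z)" for z :: 'h
      by (intro semilin_tprod_left action_semilin semilin_star)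
    have "tlift (\<lambda>x1 x2. ?f x1 x2 z) (comult x) = star a \<otimes> star (counit x *\<^sub>C z)" for x z
    proof -
      note push = tlift_push[where g = "\<lambda>u. induced_action \<rho> (star u) (star a) \<otimes> star z"
          and f = "\<lambda>x y. antipode x * y" and t = "comult x", OF semilin_add[OF lin]]
      have "tlift (\<lambda>x1 x2. ?f x1 x2 z) (comult x) =
          induced_action \<rho> (star (counit x *\<^sub>C 1)) (star a) \<otimes> star z"
        by (simp only: push[symmetric] antipode_left)
      also have "\<dots> = cnj (counit x) *\<^sub>C (induced_action \<rho> (star 1) (star a) \<otimes> star z)"
        by (rule semilin_scale[OF lin])
      finally show ?thesis
        by (simp add: star_one star_scaleC tprod_scaleC_right induced_action_one[OF \<rho>_counital])
    qed
    then show ?thesis by simp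
  qed
  also have "\<dots> = star a \<otimes> star h"
    by (rule tlift_counit[where g = "\<lambda>z. star a \<otimes> star z", OF semilin_tprod_right[OF semilin_star]])
  finally show ?thesis .
qed

text \<open>With \<open>S\<^sup>-(h) = S(h\<^sup>*)\<^sup>*\<close> the right-hand side is \<open>(h\<^sub>2 S\<^sup>-(h\<^sub>1)) \<cdot> a \<rtimes> h\<^sub>3\<close>, and \<open>h\<^sub>2 S\<^sup>-(h\<^sub>1) = \<epsilon>(h) 1\<close>.\<close>

lemma factored_span_tprod:
  "a \<otimes> h = tlift (\<lambda>h1 h2. factored (induced_action \<rho> (star (antipode (star h1))) a) h2) (comult h)"
proof -
  let ?f = "\<lambda>x y z. induced_action \<rho> (y * star (antipode (star x))) a \<otimes> (z :: 'h)"
  have "tlift (\<lambda>h1 h2. factored (induced_action \<rho> (star (antipode (star h1))) a) h2) (comult h) =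
      tlift (\<lambda>x y. tlift (?f x) (comult y)) (comult h)"
    by (simp add: factored_eq induced_action_mult[OF \<rho>_linear \<rho>_coassoc])
  also have "\<dots> = tlift (\<lambda>x z. tlift (\<lambda>x1 x2. ?f x1 x2 z) (comult x)) (comult h)"
  proof (rule tlift_comult_coassoc)
    show "semilin (\<lambda>c. c) (\<lambda>x. ?f x y z)" for y z
      using antipode_linear by (intro semilin_tprod_left action_semilin)
        (simp add: semilin_def clinear_iff star_add star_scaleC distrib_left scaleC_mult_right)
    show "semilin (\<lambda>c. c) (\<lambda>y. ?f x y z)" for x z
      by (intro semilin_tprod_left action_semilin)
        (simp add: semilin_def distrib_right scaleC_mult_left)
    show "semilin (\<lambda>c. c) (?f x y)" for x y
      by (intro semilin_tprod_right semilin_id)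
  qed
  also have "\<dots> = tlift (\<lambda>x z. a \<otimes> (counit x *\<^sub>C z)) (comult h)"
  proof -
    have lin: "semilin (\<lambda>c. c) (\<lambda>u. induced_action \<rho> u a \<otimes> z)" for z :: 'h
      by (intro semilin_tprod_left action_semilin semilin_id)
    have "tlift (\<lambda>x1 x2. ?f x1 x2 z) (comult x) = a \<otimes> (counit x *\<^sub>C z)" for x z
    proof -
      note push = tlift_push[where g = "\<lambda>u. induced_action \<rho> u a \<otimes> z"
          and f = "\<lambda>x y. y * star (antipode (star x))" and t = "comult x", OF semilin_add[OF lin]]
      have "tlift (\<lambda>x1 x2. ?f x1 x2 z) (comult x) = induced_action \<rho> (counit x *\<^sub>C 1) a \<otimes> z"
        by (simp only: push[symmetric] antipode_inverse)
      also have "\<dots> = counit x *\<^sub>C (induced_action \<rho> 1 a \<otimes> z)"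
        by (rule semilin_scale[OF lin])
      finally show ?thesis
        by (simp add: tprod_scaleC_right induced_action_one[OF \<rho>_counital])
    qed
    then show ?thesis by simp
  qed
  also have "\<dots> = a \<otimes> h"
    by (rule tlift_counit[where g = "\<lambda>z. a \<otimes> z", OF semilin_tprod_right[OF semilin_id]])
  finally show ?thesis by (rule sym)
qed

lemma factored_span:
  obtains n :: nat and b h where "c = (\<Sum>i<n. factored (b i) (h i))"
proof -
  note bal = bisemilin_balanced[OF factored_bilinear]
  have "\<exists>d. c = tlift factored d"
  proof (induction c rule: tensor_induct)
    case zero
    show ?case by (rule exI[of _ 0]) (simp add: tlift_zero[OF bal])
  next
    case (add a h c)
    then obtain d where d: "c = tlift factored d" by blast
    let ?e = "tlift (\<lambda>h1 h2. induced_action \<rho> (star (antipode (star h1))) a \<otimes> h2) (comult h)"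
    have "tlift factored ?e =
        tlift (\<lambda>h1 h2. tlift factored (induced_action \<rho> (star (antipode (star h1))) a \<otimes> h2)) (comult h)"
      by (rule tlift_push) (rule tlift_add[OF bal])
    also have "\<dots> = a \<otimes> h"
      by (simp only: tlift_tprod[OF bal] factored_span_tprod[of a h])
    finally have "a \<otimes> h + c = tlift factored (?e + d)"
      by (simp only: d tlift_add[OF bal])
    then show ?case by (rule exI)
  qed
  then obtain d where d: "c = tlift factored d" by blast
  obtain n :: nat and b h where "tlift factored d = (\<Sum>i<n. factored (b i) (h i))"
    by (rule tlift_as_sum)
  with d show thesis using that by simp
qed

text \<open>Associativity of the crossed product in the only case needed: \<open>(a \<rtimes> h)(1 \<rtimes> l) = a \<rtimes> h l\<close>, followed by
  multiplication with \<open>b \<rtimes> 1\<close>. It holds since \<open>\<Delta>\<close> is multiplicative.\<close>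

lemma crossed_mult_factored:
  "crossed_mult (*) \<rho> (a \<otimes> h) (factored b l) = crossed_mult (*) \<rho> (a \<otimes> (h * l)) (crossed_embed b)"
proof -
  have bil: "bisemilin (\<lambda>c. c) (\<lambda>h1 h2. (a * induced_action \<rho> h1 b) \<otimes> h2)"
    by (intro bisemilinI semilin_tprod_left semilin_tprod_right semilin_id
        semilin_compose[OF clinear_mult_right] action_semilin)
  have "crossed_mult (*) \<rho> (a \<otimes> h) (factored b l) =
      tlift (\<lambda>l1 l2. crossed_mult (*) \<rho> (a \<otimes> h) (induced_action \<rho> l1 b \<otimes> l2)) (comult l)"
    unfolding factored_eq
    by (rule tlift_push) (rule semilin_add[OF crossed_product_mult_right])
  also have "\<dots> = tlift (\<lambda>l1 l2. tlift (\<lambda>h1 h2.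
      (a * induced_action \<rho> (h1 * l1) b) \<otimes> (h2 * l2)) (comult h)) (comult l)"
    by (simp add: crossed_product_mult_tprod induced_action_mult[OF \<rho>_linear \<rho>_coassoc])
  also have "\<dots> = tlift (\<lambda>h1 h2. (a * induced_action \<rho> h1 b) \<otimes> h2) (comult (h * l))"
    by (subst tlift_swap) (rule tlift_comult_mult[OF bil, symmetric])
  finally show ?thesis
    by (simp add: crossed_embed_def crossed_product_mult_tprod)
qed

lemma positive_E1:
  assumes haar: "haar_trace \<tau>"
  shows "positive (E1 \<tau> (crossed_mult (*) \<rho> (crossed_star \<rho> c) c))"
proof -
  interpret semi_inner "\<lambda>h l. \<tau> (star h * l)" by (rule haar_semi_inner[OF haar])
  obtain n :: nat and b h where c: "c = (\<Sum>i<n. factored (b i) (h i))"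
    by (rule factored_span)
  have "E1 \<tau> (crossed_mult (*) \<rho> (star (b i) \<otimes> star (h i)) (factored (b j) (h j))) =
      \<tau> (star (h i) * h j) *\<^sub>C (star (b i) * b j)" for i j
    by (simp add: crossed_mult_factored E1_pure[OF haar] scaleC_mult_left
        E1_crossed_mult_right[OF clinear_mult_left clinear_mult_right \<rho>_linear \<rho>_counital haar])
  then have "E1 \<tau> (crossed_mult (*) \<rho> (crossed_star \<rho> c) c) =
      (\<Sum>i<n. \<Sum>j<n. \<tau> (star (h i) * h j) *\<^sub>C (star (b i) * b j))"
    by (simp add: c semilin_sum[OF crossed_star_semilin] crossed_star_factored
        semilin_sum[OF crossed_product_mult_left] semilin_sum[OF crossed_product_mult_right]
        semilin_sum[OF E1_clinear[OF haar, unfolded clinear_semilin]]) (rule sum.swap)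
  then show ?thesis
    by (simp add: positive_gram)
qed

lemma crossed_product_conditional_expectation:
  assumes haar: "haar_trace \<tau>"
  shows "conditional_expectation (crossed_mult (*) \<rho>) (crossed_star \<rho>) crossed_embed (E1 \<tau>)"
proof (rule conditional_expectation.intro)
  show "clinear (E1 \<tau> :: 'a \<otimes> 'h \<Rightarrow> 'a)" by (rule E1_clinear[OF haar])
  show "E1 \<tau> (crossed_embed a) = a" for a :: 'a by (rule E1_embed[OF haar])
  show "E1 \<tau> (crossed_mult (*) \<rho> (crossed_embed a) c) = a * E1 \<tau> c" for a c
    by (rule E1_crossed_mult_left[OF clinear_mult_left clinear_mult_right \<rho>_linear \<rho>_counital haar])
  show "E1 \<tau> (crossed_mult (*) \<rho> c (crossed_embed a)) = E1 \<tau> c * a" for a c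
    by (rule E1_crossed_mult_right[OF clinear_mult_left clinear_mult_right \<rho>_linear \<rho>_counital haar])
  fix c assume "positive_in (crossed_mult (*) \<rho>) (crossed_star \<rho>) c"
  then obtain ys where c: "c = (\<Sum>y\<leftarrow>ys. crossed_mult (*) \<rho> (crossed_star \<rho> y) y)"
    by (auto simp: positive_in_def)
  note lin = E1_clinear[OF haar, where 'v = 'a, unfolded clinear_semilin]
  show "positive (E1 \<tau> c)"
    unfolding c by (induction ys)
      (simp_all add: semilin_zero[OF lin] semilin_add[OF lin] positive_zero positive_add positive_E1[OF haar])
qed

end

section \<open>Inner products of the crossed product bimodule\<close>

text \<open>Since \<open>\<Delta>(1) = 1 \<otimes> 1\<close>, the second Sweedler sum disappears when the second argument lies in \<open>X\<close>. The
  coefficient \<open>S(h\<^sub>1)\<^sup>*\<close> is conjugate linear in \<open>h\<^sub>1\<close> and the inner product is conjugate linear in its second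
  variable, so the remaining summand is linear in \<open>h\<^sub>1\<close>, as invariance of the Haar trace requires.\<close>

lemma
  fixes lip :: "'x::complex_vector \<Rightarrow> 'x \<Rightarrow> 'a::cstar_algebra" and \<xi> :: "'x \<Rightarrow> 'x \<otimes> 'h dual"
  assumes lip1: "\<And>y. clinear (\<lambda>x. lip x y)" and lip2: "\<And>x. semilin cnj (lip x)" and \<xi>: "clinear \<xi>"
  shows crossed_lip_embed: "crossed_lip lip \<xi> (z \<otimes> h) (crossed_embed x) =
      tlift (\<lambda>h1 h2. lip z (induced_action \<xi> (star (antipode h1)) x) \<otimes> h2) (comult h)"
    and crossed_lip_semilin_left: "semilin (\<lambda>c. c) (\<lambda>s. crossed_lip lip \<xi> s t)"
    and clinear_lip_action: "clinear (\<lambda>h. lip z (induced_action \<xi> (star (antipode h)) x))"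
proof -
  let ?g = "\<lambda>x h1 h2 y l1 l2.
    lip x (induced_action \<xi> (star (antipode (h1 * star l1))) y) \<otimes> (h2 * star l2 :: 'h)"
  let ?G = "\<lambda>x h y l. tlift (\<lambda>h1 h2. tlift (?g x h1 h2 y) (comult l)) (comult h)"
  note defs = semilin_def clinear_iff star_add star_scaleC distrib_left distrib_right
    scaleC_mult_left scaleC_mult_right
  have lip_l1: "semilin cnj (\<lambda>l1. lip x (induced_action \<xi> (star (antipode (h1 * star l1))) y))" for x h1 y
    using antipode_linear clinear_induced_action_left[of \<xi>] lip2 by (simp add: defs)
  have lip_h1: "clinear (\<lambda>h1. lip x (induced_action \<xi> (star (antipode (h1 * l))) y))" for x l y
    using antipode_linear clinear_induced_action_left[of \<xi>] lip2 by (simp add: defs)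
  have lip_y: "semilin cnj (\<lambda>y. lip x (induced_action \<xi> k y))" for x k
    using clinear_induced_action[OF \<xi>] lip2 by (simp add: defs)
  have g_l: "bisemilin cnj (?g x h1 h2 y)" for x h1 h2 y
    by (intro bisemilinI semilin_tprod_left semilin_tprod_right lip_l1) (simp add: defs)
  have G_yl: "bisemilin cnj (?G x h)" for x h
    by (intro bisemilinI semilin_tlift_fun semilin_tlift_arg comult_linear g_l semilin_tprod_left lip_y)
  have g_h: "bisemilin (\<lambda>c. c) (\<lambda>h1 h2. tlift (?g x h1 h2 y) (comult l))" for x y l
    by (intro bisemilinI semilin_tlift_fun semilin_tprod_left semilin_tprod_right
        lip_h1[unfolded clinear_semilin]) (simp add: defs)
  have out: "bisemilin (\<lambda>c. c) (\<lambda>x h. tlift (?G x h) t)" for t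
    by (intro bisemilinI semilin_tlift_fun semilin_tlift_arg comult_linear g_h semilin_tprod_left
        lip1[unfolded clinear_semilin])
  show "semilin (\<lambda>c. c) (\<lambda>s. crossed_lip lip \<xi> s t)"
    unfolding crossed_lip_def by (rule semilin_tlift[OF out])
  show "crossed_lip lip \<xi> (z \<otimes> h) (crossed_embed x) =
      tlift (\<lambda>h1 h2. lip z (induced_action \<xi> (star (antipode h1)) x) \<otimes> h2) (comult h)"
    unfolding crossed_lip_def crossed_embed_def
    by (subst tlift_tprod[OF bisemilin_balanced[OF out]],
        subst tlift_tprod[OF bisemilin_balanced[OF G_yl]]) (simp add: tlift_comult_one[OF g_l] star_one)
  show "clinear (\<lambda>h. lip z (induced_action \<xi> (star (antipode h)) x))"
    using lip_h1[of z 1 x] by simp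
qed

text \<open>As \<open>\<Delta>\<close> preserves involutions, the sum over \<open>h\<^sub>1\<^sup>* \<otimes> h\<^sub>2\<^sup>*\<close> is a sum over \<open>\<Delta>(h\<^sup>*)\<close>. Its summand is linear
  in the components of \<open>\<Delta>(h\<^sup>*)\<close>, so invariance of the Haar trace applies to \<open>h\<^sup>*\<close>.\<close>

lemma
  fixes rip :: "'x::complex_vector \<Rightarrow> 'x \<Rightarrow> 'b::cstar_algebra" and \<sigma> :: "'b \<Rightarrow> 'b \<otimes> 'h dual"
  assumes rip1: "\<And>y. semilin cnj (\<lambda>x. rip x y)" and rip2: "\<And>x. clinear (rip x)" and \<sigma>: "clinear \<sigma>"
  shows crossed_rip_embed: "crossed_rip rip \<sigma> (z \<otimes> h) (crossed_embed x) =
      tlift (\<lambda>h1 h2. induced_action \<sigma> h1 (rip z x) \<otimes> h2) (comult (star h))"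
    and crossed_rip_semilin_left: "semilin cnj (\<lambda>s. crossed_rip rip \<sigma> s t)"
proof -
  let ?g = "\<lambda>x y l h1 h2. induced_action \<sigma> (star h1) (rip x y) \<otimes> (star h2 * l :: 'h)"
  let ?G = "\<lambda>x h y l. tlift (?g x y l) (comult h)"
  note defs = semilin_def clinear_iff star_add star_scaleC distrib_left distrib_right
    scaleC_mult_left scaleC_mult_right
  have act: "semilin cnj (\<lambda>h. induced_action \<sigma> (star h) b)" for b
    using clinear_induced_action_left[of \<sigma>] by (simp add: defs)
  have act_x: "semilin cnj (\<lambda>x. induced_action \<sigma> k (rip x y))"
    and act_y: "semilin (\<lambda>c. c) (\<lambda>y. induced_action \<sigma> k (rip x y))" for k x y
    using clinear_induced_action[OF \<sigma>] rip1 rip2 by (simp_all add: defs)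
  have g_h: "bisemilin cnj (?g x y l)" for x y l
    by (intro bisemilinI semilin_tprod_left semilin_tprod_right act) (simp add: defs)
  have G_yl: "bisemilin (\<lambda>c. c) (?G x h)" for x h
    by (intro bisemilinI semilin_tlift_fun semilin_tprod_left semilin_tprod_right act_y) (simp add: defs)
  have out: "bisemilin cnj (\<lambda>x h. tlift (?G x h) t)" for t
    by (intro bisemilinI semilin_tlift_fun semilin_tlift_arg comult_linear g_h semilin_tprod_left act_x)
  have act_bilinear: "bisemilin (\<lambda>c. c) (\<lambda>h1 h2. induced_action \<sigma> h1 b \<otimes> h2)" for b
    by (intro bisemilinI semilin_tprod_left semilin_tprod_right
        clinear_induced_action_left[unfolded clinear_semilin]) (simp add: semilin_def)
  show "semilin cnj (\<lambda>s. crossed_rip rip \<sigma> s t)"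
    unfolding crossed_rip_def by (rule semilin_tlift[OF out])
  show "crossed_rip rip \<sigma> (z \<otimes> h) (crossed_embed x) =
      tlift (\<lambda>h1 h2. induced_action \<sigma> h1 (rip z x) \<otimes> h2) (comult (star h))"
    unfolding crossed_rip_def crossed_embed_def
    by (subst tlift_tprod[OF bisemilin_balanced[OF out]],
        subst tlift_tprod[OF bisemilin_balanced[OF G_yl]]) (simp add: tlift_comult_star[OF act_bilinear])
qed

lemma crossed_lip_embed_embed:
  fixes lip :: "'x::complex_vector \<Rightarrow> 'x \<Rightarrow> 'a::cstar_algebra" and \<xi> :: "'x \<Rightarrow> 'x \<otimes> 'h dual"
  assumes lip: "\<And>y. clinear (\<lambda>x. lip x y)" "\<And>x. semilin cnj (lip x)" "clinear \<xi>"
    and counital: "counital \<xi>"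
  shows "crossed_lip lip \<xi> (crossed_embed z) (crossed_embed x) = crossed_embed (lip z x)"
proof -
  have bil: "bisemilin (\<lambda>c. c) (\<lambda>h1 h2. lip z (induced_action \<xi> (star (antipode h1)) x) \<otimes> h2)"
    by (intro bisemilinI semilin_tprod_left semilin_tprod_right
        clinear_lip_action[OF lip, unfolded clinear_semilin]) (simp add: semilin_def)
  have "crossed_lip lip \<xi> (z \<otimes> 1) (crossed_embed x) = lip z x \<otimes> 1"
    unfolding crossed_lip_embed[OF lip] tlift_comult_one[OF bil]
    by (simp add: antipode_one star_one induced_action_one[OF counital])
  then show ?thesis by (simp add: crossed_embed_def)
qed

lemma E1_crossed_lip:
  fixes lip :: "'x::complex_vector \<Rightarrow> 'x \<Rightarrow> 'a::cstar_algebra" and \<xi> :: "'x \<Rightarrow> 'x \<otimes> 'h dual"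
  assumes lip: "\<And>y. clinear (\<lambda>x. lip x y)" "\<And>x. semilin cnj (lip x)" "clinear \<xi>"
    and counital: "counital \<xi>" and haar: "haar_trace \<tau>"
  shows "E1 \<tau> (crossed_lip lip \<xi> y (crossed_embed x)) = lip (E1 \<tau> y) x"
proof -
  note linX = E1_clinear[OF haar, where 'v = 'x, unfolded clinear_semilin]
    and linA = E1_clinear[OF haar, where 'v = 'a, unfolded clinear_semilin]
    and lins = crossed_lip_semilin_left[OF lip] and linl = lip(1)[unfolded clinear_semilin]
  show ?thesis
  proof (induction y rule: tensor_induct)
    case zero
    show ?case
      by (simp add: semilin_zero[OF lins] semilin_zero[OF linA] semilin_zero[OF linX]
          semilin_zero[where f = "\<lambda>x. lip x _", OF linl])
  next
    case (add z h y)
    have "E1 \<tau> (crossed_lip lip \<xi> (z \<otimes> h) (crossed_embed x)) = \<tau> h *\<^sub>C lip z x"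
      unfolding crossed_lip_embed[OF lip] E1_sweedler[OF haar clinear_lip_action[OF lip]]
      by (simp add: antipode_one star_one induced_action_one[OF counital])
    with add show ?case
      by (simp add: semilin_add[OF lins] semilin_add[OF linA] semilin_add[OF linX] E1_pure[OF haar]
          semilin_add[where f = "\<lambda>x. lip x _", OF linl] semilin_scale[where f = "\<lambda>x. lip x _", OF linl])
  qed
qed

lemma crossed_rip_embed_embed:
  fixes rip :: "'x::complex_vector \<Rightarrow> 'x \<Rightarrow> 'b::cstar_algebra" and \<sigma> :: "'b \<Rightarrow> 'b \<otimes> 'h dual"
  assumes rip: "\<And>y. semilin cnj (\<lambda>x. rip x y)" "\<And>x. clinear (rip x)" "clinear \<sigma>"
    and counital: "counital \<sigma>"
  shows "crossed_rip rip \<sigma> (crossed_embed z) (crossed_embed x) = crossed_embed (rip z x)"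
proof -
  have bil: "bisemilin (\<lambda>c. c) (\<lambda>h1 h2. induced_action \<sigma> h1 b \<otimes> h2)" for b
    by (intro bisemilinI semilin_tprod_left semilin_tprod_right
        clinear_induced_action_left[unfolded clinear_semilin]) (simp add: semilin_def)
  have "crossed_rip rip \<sigma> (z \<otimes> 1) (crossed_embed x) = rip z x \<otimes> 1"
    unfolding crossed_rip_embed[OF rip] star_one tlift_comult_one[OF bil]
    by (simp add: induced_action_one[OF counital])
  then show ?thesis by (simp add: crossed_embed_def)
qed

text \<open>Invariance gives \<open>\<tau>(h\<^sup>*) \<langle>z, x\<rangle>\<close>, and \<open>\<tau>(h\<^sup>*) = cnj (\<tau>(h))\<close> is the scalar produced by the conjugate linear
  first variable.\<close>

lemma E1_crossed_rip:
  fixes rip :: "'x::complex_vector \<Rightarrow> 'x \<Rightarrow> 'b::cstar_algebra" and \<sigma> :: "'b \<Rightarrow> 'b \<otimes> 'h dual"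
  assumes rip: "\<And>y. semilin cnj (\<lambda>x. rip x y)" "\<And>x. clinear (rip x)" "clinear \<sigma>"
    and counital: "counital \<sigma>" and haar: "haar_trace \<tau>"
  shows "E1 \<tau> (crossed_rip rip \<sigma> y (crossed_embed x)) = rip (E1 \<tau> y) x"
proof -
  note linX = E1_clinear[OF haar, where 'v = 'x, unfolded clinear_semilin]
    and linB = E1_clinear[OF haar, where 'v = 'b, unfolded clinear_semilin]
    and lins = crossed_rip_semilin_left[OF rip] and linr = rip(1)
  show ?thesis
  proof (induction y rule: tensor_induct)
    case zero
    show ?case
      by (simp add: semilin_zero[OF lins] semilin_zero[OF linB] semilin_zero[OF linX]
          semilin_zero[where f = "\<lambda>x. rip x _", OF linr])
  next
    case (add z h y)
    have "E1 \<tau> (crossed_rip rip \<sigma> (z \<otimes> h) (crossed_embed x)) = cnj (\<tau> h) *\<^sub>C rip z x"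
      unfolding crossed_rip_embed[OF rip] E1_sweedler[OF haar clinear_induced_action_left]
      by (simp add: haar_star[OF haar] induced_action_one[OF counital])
    with add show ?case
      by (simp add: semilin_add[OF lins] semilin_add[OF linB] semilin_add[OF linX] E1_pure[OF haar]
          semilin_add[where f = "\<lambda>x. rip x _", OF linr] semilin_scale[where f = "\<lambda>x. rip x _", OF linr])
  qed
qed

end

theorem proposition4p1:
  fixes \<rho> :: "'a::cstar_algebra \<Rightarrow> 'a \<otimes> 'h::{cstar_algebra, hopf_structure} dual"
    and \<sigma> :: "'b::cstar_algebra \<Rightarrow> 'b \<otimes> 'h dual"
    and \<xi> :: "'x::complex_vector \<Rightarrow> 'x \<otimes> 'h dual"
    and lact :: "'a \<Rightarrow> 'x \<Rightarrow> 'x" and ract :: "'x \<Rightarrow> 'b \<Rightarrow> 'x"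
    and lip :: "'x \<Rightarrow> 'x \<Rightarrow> 'a" and rip :: "'x \<Rightarrow> 'x \<Rightarrow> 'b"
    and \<tau> :: "'h \<Rightarrow> complex"
  assumes hopf: "cstar_hopf_algebra TYPE('h)"
    and coaction_A: "coaction \<rho>" and coaction_B: "coaction \<sigma>"
    and equivalence: "equivalence_bimodule lact ract lip rip"
    and coaction_X: "bimodule_coaction lact ract lip rip \<rho> \<sigma> \<xi>"
    and haar: "haar_trace \<tau>"
  shows "bimodule_conditional_expectation
    (crossed_mult (*) \<rho>) (crossed_star \<rho>) crossed_embed (E1 \<tau>)
    (crossed_mult (*) \<sigma>) (crossed_star \<sigma>) crossed_embed (E1 \<tau>)
    (crossed_mult lact \<xi>) (crossed_mult ract \<sigma>) (crossed_lip lip \<xi>) (crossed_rip rip \<sigma>)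
    crossed_embed (E1 \<tau>)"
proof -
  interpret cstar_hopf_algebra "TYPE('h)" by (rule hopf)
  interpret equivalence_bimodule lact ract lip rip by (rule equivalence)
  interpret A: conditional_expectation "crossed_mult (*) \<rho>" "crossed_star \<rho>" crossed_embed "E1 \<tau>"
    by (rule crossed_product_conditional_expectation[OF coaction_A haar])
  interpret B: conditional_expectation "crossed_mult (*) \<sigma>" "crossed_star \<sigma>" crossed_embed "E1 \<tau>"
    by (rule crossed_product_conditional_expectation[OF coaction_B haar])
  have \<xi>: "clinear \<xi>" "counital \<xi>"
    using coaction_X by (auto simp: bimodule_coaction_def)
  have \<sigma>: "clinear \<sigma>" "counital \<sigma>"
    using coaction_B by (auto simp: coaction_def)
  have lip_cnj: "semilin cnj (lip x)" for x
    unfolding semilin_def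
    by (metis lip_star lip_linear[unfolded clinear_iff] star_add star_scaleC)
  have rip_cnj: "semilin cnj (\<lambda>x. rip x y)" for y
    unfolding semilin_def
    by (metis rip_star rip_linear[unfolded clinear_iff] star_add star_scaleC)
  note lact = lact_linear_left lact_linear_right \<xi>(1)
    and ract = ract_linear_left ract_linear_right \<sigma>(1)
    and lip = lip_linear lip_cnj \<xi>(1) and rip = rip_cnj rip_linear \<sigma>(1)
  show ?thesis
  proof (intro bimodule_conditional_expectation.intro bimodule_conditional_expectation_axioms.intro
      A.conditional_expectation_axioms B.conditional_expectation_axioms)
    show "clinear (E1 \<tau> :: 'x \<otimes> 'h \<Rightarrow> 'x)" by (rule E1_clinear[OF haar])
    show "surj (E1 \<tau> :: 'x \<otimes> 'h \<Rightarrow> 'x)" by (rule surjI) (rule E1_embed[OF haar])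
  qed (simp_all add: E1_crossed_mult_left[OF lact \<xi>(2) haar] E1_crossed_mult_right[OF lact \<xi>(2) haar]
      E1_crossed_mult_left[OF ract \<sigma>(2) haar] E1_crossed_mult_right[OF ract \<sigma>(2) haar]
      crossed_mult_embed[OF lact \<xi>(2)] crossed_mult_embed[OF ract \<sigma>(2)]
      E1_crossed_lip[OF lip \<xi>(2) haar] crossed_lip_embed_embed[OF lip \<xi>(2)]
      E1_crossed_rip[OF rip \<sigma>(2) haar] crossed_rip_embed_embed[OF rip \<sigma>(2)])
qed

end
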